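(* Let $D\subset H_1=\mathbb{R}^3$ be a bounded convex domain with smooth boundary $\Sigma=\partial D$. For an oriented horizontal line $G$ intersecting $D$, let $\sigma=\sigma(G)$ be the length, with respect to the Levi metric, of the chord $G\cap D$. Then the average chord length over the oriented horizontal lines intersecting $D$ is $$\frac{\int_{G\cap D\neq\emptyset}\sigma\,dG}{\int_{G\cap D\neq\emptyset}dG}=\frac{2\pi\,V(D)}{2\cdot\text{p-Area}(\Sigma)},$$ where the integrals are over oriented horizontal lines $G=G_{p,\theta,t}$ meeting $D$, $dG=dp\wedge d\theta\wedge dt$ (taken in absolute value), $V(D)$ is the Lebesgue volume of $D$, and $\text{p-Area}(\Sigma)$ is the p-area of $\Sigma$.
   Context: The 3D-Heisenberg group $H_1$ is $\mathbb{R}^3$ with coordinates $(x,y,t)$ and group law $(a,b,c)\circ(x,y,t)=(a+x,\,b+y,\,c+t+bx-ay)$. Put $\mathring e_1=\partial_x+y\,\partial_t$, $\mathring e_2=\partial_y-x\,\partial_t$, $T=\partial_t$. The contact plane field is $\xi=\mathrm{span}\{\mathring e_1,\mathring e_2\}=\ker\Theta$, $\Theta=dt+x\,dy-y\,dx$; $J$ on $\xi$ is given by $J\mathring e_1=\mathring e_2$, $J\mathring e_2=-\mathring e_1$. The Levi metric is the inner product on $\xi$ for which $\mathring e_1,\mathring e_2$ are orthonormal ($dx^2+dy^2$ restricted to $\xi$). Convexity is meant in $\mathbb{R}^3$. A horizontal line is a straight line in $\mathbb{R}^3$ whose velocity vector is everywhere in $\xi$. Oriented horizontal lines are parametrized by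 $(p,\theta,t)\in\mathbb{R}\times[0,2\pi)\times\mathbb{R}$: $G_{p,\theta,t}$ is the line $$s\mapsto (p\cos\theta+s\sin\theta,\;p\sin\theta-s\cos\theta,\;t+sp),\qquad s\in\mathbb{R},$$ oriented by increasing $s$; here $s$ is arc length for the Levi metric. The length of the part of a horizontal line $\gamma$ between $\gamma(s_0)$ and $\gamma(s_1)$ is $\int_{s_0}^{s_1}|\gamma'(s)|\,ds$, with $|\cdot|$ the Levi norm. p-Area: a point $q\in\Sigma$ is singular if $\xi_q=T_q\Sigma$ and regular otherwise. At regular points let $e_1\in\xi\cap T\Sigma$ be a unit vector for the Levi metric (unique up to sign), $e_2=Je_1$, and let $(\omega^1,\omega^2,\Theta)$ be the coframe dual to $(e_1,e_2,T)$. Then $\text{p-Area}(\Sigma)=\int_\Sigma\Theta\wedge\omega^1$, where the form is extended by $0$ to singular points and signs are chosen so that the integrand is a nonnegative area density. *)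

theory Defs
  imports "HOL-Analysis.Analysis"
begin

section \<open>The Heisenberg group as a contact manifold\<close>

text \<open>Points of $H_1$ and tangent vectors at them are triples \<open>(x, y, t)\<close>.\<close>

type_synonym heis = "real \<times> real \<times> real"

text \<open>The standard frame \<open>\<partial>\<^sub>x + y \<partial>\<^sub>t\<close>, \<open>\<partial>\<^sub>y - x \<partial>\<^sub>t\<close>, \<open>\<partial>\<^sub>t\<close>.\<close>

definition std_e1 :: "heis \<Rightarrow> heis" where
  "std_e1 = (\<lambda>(x, y, t). (1, 0, y))"

definition std_e2 :: "heis \<Rightarrow> heis" where
  "std_e2 = (\<lambda>(x, y, t). (0, 1, - x))"

definition T_field :: heis where
  "T_field = (0, 0, 1)"

definition xi :: "heis \<Rightarrow> heis set" where
  "xi q = span {std_e1 q, std_e2 q}"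

definition Theta :: "heis \<Rightarrow> heis \<Rightarrow> real" where
  "Theta = (\<lambda>(x, y, t) (dx, dy, dt). dt + x * dy - y * dx)"

text \<open>
  For \<open>v = (dx, dy, dt)\<close> in \<open>xi q\<close> one has \<open>v = dx *\<^sub>R std_e1 q + dy *\<^sub>R std_e2 q\<close>.
  Hence \<open>J\<close> and the Levi metric can be read off from \<open>dx\<close> and \<open>dy\<close>; both are meaningful
  only for vectors in \<open>xi q\<close>.
\<close>

definition J :: "heis \<Rightarrow> heis \<Rightarrow> heis" where
  "J q = (\<lambda>(dx, dy, dt). dx *\<^sub>R std_e2 q - dy *\<^sub>R std_e1 q)"

definition levi_inner :: "heis \<Rightarrow> heis \<Rightarrow> real" where
  "levi_inner = (\<lambda>(dx, dy, dt) (dx', dy', dt'). dx * dx' + dy * dy')"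

definition levi_norm :: "heis \<Rightarrow> real" where
  "levi_norm v = sqrt (levi_inner v v)"


section \<open>Smooth surfaces\<close>

text \<open>
  Continuous differentiability of order \<open>k\<close>, intended for open \<open>S\<close> only (the derivative is taken
  in the ambient space).
\<close>

primrec Ck_on :: "nat \<Rightarrow> 'a::real_normed_vector set \<Rightarrow> ('a \<Rightarrow> 'b::real_normed_vector) \<Rightarrow> bool" where
  "Ck_on 0 S f \<longleftrightarrow> continuous_on S f"
| "Ck_on (Suc k) S f \<longleftrightarrow>
     (\<forall>x\<in>S. f differentiable (at x)) \<and>
     (\<forall>v. Ck_on k S (\<lambda>x. frechet_derivative f (at x) v))"

definition smooth_on :: "'a::real_normed_vector set \<Rightarrow> ('a \<Rightarrow> 'b::real_normed_vector) \<Rightarrow> bool" where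
  "smooth_on S f \<longleftrightarrow> (\<forall>k. Ck_on k S f)"

definition local_parametrization ::
    "heis set \<Rightarrow> (real \<times> real) set \<Rightarrow> (real \<times> real \<Rightarrow> heis) \<Rightarrow> bool" where
  "local_parametrization \<Sigma> U X \<longleftrightarrow>
     open U \<and> smooth_on U X \<and>
     (\<forall>u\<in>U. inj (frechet_derivative X (at u))) \<and>
     openin (top_of_set \<Sigma>) (X ` U) \<and>
     (\<exists>Y. homeomorphism U (X ` U) X Y)"

definition smooth_surface :: "heis set \<Rightarrow> bool" where
  "smooth_surface \<Sigma> \<longleftrightarrow> (\<forall>q\<in>\<Sigma>. \<exists>U X. local_parametrization \<Sigma> U X \<and> q \<in> X ` U)"

definition tangent_space :: "heis set \<Rightarrow> heis \<Rightarrow> heis set" where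
  "tangent_space \<Sigma> q =
     {v. \<exists>c :: real \<Rightarrow> heis. c 0 = q \<and> (\<forall>\<^sub>F s in nhds 0. c s \<in> \<Sigma>) \<and>
           (c has_vector_derivative v) (at 0)}"


section \<open>Integration of area densities and the p-area\<close>

text \<open>
  An area density assigns to a point \<open>q\<close> and tangent vectors \<open>v\<close>, \<open>w\<close> the value
  $|\omega_q(v,w)|$ of a 2-form $\omega$. Its integral is computed by cutting the surface into
  countably many disjoint Borel pieces, each lying in the image of a local parametrization, and
  pulling back to the parameter domains; the value does not depend on the choices.
\<close>

definition chart_decomposition ::
    "heis set \<Rightarrow> (nat \<Rightarrow> (real \<times> real) set) \<Rightarrow> (nat \<Rightarrow> real \<times> real \<Rightarrow> heis) \<Rightarrow>
     (nat \<Rightarrow> (real \<times> real) set) \<Rightarrow> bool" where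
  "chart_decomposition \<Sigma> U X A \<longleftrightarrow>
     (\<forall>n. local_parametrization \<Sigma> (U n) (X n) \<and> A n \<in> sets borel \<and> A n \<subseteq> U n) \<and>
     disjoint_family (\<lambda>n. X n ` A n) \<and>
     (\<Union>n. X n ` A n) = \<Sigma>"

definition has_density_integral ::
    "(heis \<Rightarrow> heis \<Rightarrow> heis \<Rightarrow> real) \<Rightarrow> ennreal \<Rightarrow> heis set \<Rightarrow> bool" where
  "has_density_integral \<delta> I \<Sigma> \<longleftrightarrow>
     (\<exists>U X A. chart_decomposition \<Sigma> U X A \<and>
        I = (\<Sum>n. \<integral>\<^sup>+u\<in>A n. ennreal (\<delta> (X n u)
                   (frechet_derivative (X n) (at u) (1, 0))
                   (frechet_derivative (X n) (at u) (0, 1))) \<partial>lborel))"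

definition density_integral :: "heis set \<Rightarrow> (heis \<Rightarrow> heis \<Rightarrow> heis \<Rightarrow> real) \<Rightarrow> ennreal" where
  "density_integral \<Sigma> \<delta> = (THE I. has_density_integral \<delta> I \<Sigma>)"

definition singular_point :: "heis set \<Rightarrow> heis \<Rightarrow> bool" where
  "singular_point \<Sigma> q \<longleftrightarrow> xi q = tangent_space \<Sigma> q"

text \<open>At a regular point \<open>e1\<close> is unique up to sign, and the density below ignores the sign.\<close>

definition e1 :: "heis set \<Rightarrow> heis \<Rightarrow> heis" where
  "e1 \<Sigma> q = (SOME v. v \<in> xi q \<inter> tangent_space \<Sigma> q \<and> levi_norm v = 1)"

definition e2 :: "heis set \<Rightarrow> heis \<Rightarrow> heis" where
  "e2 \<Sigma> q = J q (e1 \<Sigma> q)"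

text \<open>The first member of the coframe dual to \<open>(e1, e2, T_field)\<close>.\<close>

definition omega1 :: "heis set \<Rightarrow> heis \<Rightarrow> heis \<Rightarrow> real" where
  "omega1 \<Sigma> q v =
     (THE a. \<exists>b c. v = a *\<^sub>R e1 \<Sigma> q + b *\<^sub>R e2 \<Sigma> q + c *\<^sub>R T_field)"

text \<open>$|\Theta\wedge\omega^1|$, extended by \<open>0\<close> to the singular points.\<close>

definition p_area_density :: "heis set \<Rightarrow> heis \<Rightarrow> heis \<Rightarrow> heis \<Rightarrow> real" where
  "p_area_density \<Sigma> q v w =
     (if singular_point \<Sigma> q then 0
      else \<bar>Theta q v * omega1 \<Sigma> q w - Theta q w * omega1 \<Sigma> q v\<bar>)"

definition p_area :: "heis set \<Rightarrow> ennreal" where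
  "p_area \<Sigma> = density_integral \<Sigma> (p_area_density \<Sigma>)"


section \<open>Oriented horizontal lines\<close>

text \<open>
  A triple \<open>(p, \<theta>, t)\<close> with \<open>0 \<le> \<theta> < 2 * pi\<close> encodes an oriented horizontal line; the
  measure $|dp\wedge d\theta\wedge dt|$ on lines is \<open>lborel\<close> on these triples.
\<close>

definition hline :: "real \<times> real \<times> real \<Rightarrow> real \<Rightarrow> heis" where
  "hline = (\<lambda>(p, \<theta>, t) s. (p * cos \<theta> + s * sin \<theta>, p * sin \<theta> - s * cos \<theta>, t + s * p))"

definition lines_meeting :: "heis set \<Rightarrow> (real \<times> real \<times> real) set" where
  "lines_meeting D =
     {G. G \<in> UNIV \<times> {0..<2 * pi} \<times> UNIV \<and> range (hline G) \<inter> D \<noteq> {}}"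

text \<open>
  For convex \<open>D\<close> the parameters \<open>s\<close> with \<open>hline G s \<in> D\<close> form an interval, so this is the Levi
  length of one segment.
\<close>

definition chord_length :: "heis set \<Rightarrow> real \<times> real \<times> real \<Rightarrow> real" where
  "chord_length D G =
     (LINT s:{s. hline G s \<in> D}|lborel. levi_norm (vector_derivative (hline G) (at s)))"

end

theory Submission
  imports Defs
begin

text \<open>
  Both integrals are computed direction by direction. Fix \<open>\<theta>\<close>. The horizontal lines of
  direction \<open>\<theta>\<close> are the fibres of a map \<open>hproj \<theta>\<close> from the Heisenberg group to the plane of
  parameters \<open>(p, t)\<close>, and \<open>(p, s, t)\<close> are coordinates on space that differ from the standard ones by
  an orthogonal reflection of the \<open>(x, y)\<close>-plane and a shear in \<open>t\<close>, so they preserve Lebesgue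
  measure.

  For the numerator, Tonelli's theorem shows that integrating the chord lengths over all lines of direction \<open>\<theta>\<close> gives
  the volume of \<open>D\<close>; integrating over \<open>\<theta>\<close> gives $2\pi V(D)$ (\<open>nn_integral_chord_length\<close>).

  For the denominator, the lines of direction \<open>\<theta>\<close> that meet \<open>D\<close> form the planar set \<open>hproj \<theta> ` D\<close>.
  Let \<open>n\<close> be the normal $X_u \times X_v$ of a chart \<open>X\<close> of \<open>\<Sigma> = frontier D\<close>, and put
  $A = \langle e_1, n\rangle$, $B = \langle e_2, n\rangle$ for the standard horizontal frame. The Jacobian of
  \<open>hproj \<theta>\<close> along the chart is $\langle h, n\rangle = A\sin\theta - B\cos\theta$, where \<open>h\<close> is the direction
  \<open>hdir \<theta>\<close> of the line. A line that meets \<open>D\<close> enters and leaves it exactly once, and at a point of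
  \<open>\<Sigma>\<close> whose line misses \<open>D\<close> the line lies in a supporting plane of \<open>D\<close>, which is the tangent plane,
  so the Jacobian vanishes there. Hence the integral of
  $|A\sin\theta - B\cos\theta|$ over \<open>\<Sigma>\<close> is twice the area of \<open>hproj \<theta> ` D\<close>
  (\<open>crofton_in_one_direction\<close>). On the other hand the integral over \<open>\<theta>\<close> of
  $|A\sin\theta - B\cos\theta|$ is $4\sqrt{A^2+B^2}$ (\<open>nn_integral_abs_sinusoid\<close>), and
  $\sqrt{A^2+B^2}$ is the p-area density in the chart (\<open>p_area_density_eq\<close>). Tonelli then gives
  $4\,\text{p-Area}(\Sigma) = 2\int dG$ (\<open>crofton_formula\<close>).

  The p-area is defined as the value common to all ways of cutting the surface into charts. The last
  identity holds for each of them with the same right-hand side, so it also proves that this value is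
  well defined, and no change of charts has to be considered.
\<close>

section \<open>Areas in the plane\<close>

text \<open>
  The change of variables theorem for integrals lives on the vectors \<open>real^2\<close>, whereas charts and
  lines have parameters in \<open>real \<times> real\<close>. This map and its inverse below pass from one to the other.
\<close>

definition vec_of :: "real \<times> real \<Rightarrow> real^2" where
  "vec_of = (\<lambda>(a, b). vector [a, b])"

definition pair_of :: "real^2 \<Rightarrow> real \<times> real" where
  "pair_of v = (v $ 1, v $ 2)"

definition det2 :: "real^2 \<Rightarrow> real^2 \<Rightarrow> real" where
  "det2 a b = a $ 1 * b $ 2 - a $ 2 * b $ 1"

lemma vec_of_nth [simp]: "vec_of p $ 1 = fst p" "vec_of p $ 2 = snd p"
  by (simp_all add: vec_of_def case_prod_beta)

lemma pair_of_vec_of [simp]: "pair_of (vec_of p) = p"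
  by (simp add: pair_of_def)

lemma vec_of_pair_of [simp]: "vec_of (pair_of v) = v"
  by (simp add: vec_eq_iff forall_2 pair_of_def)

lemma vec_of_eq_iff [simp]: "vec_of p = vec_of q \<longleftrightarrow> p = q"
  by (metis pair_of_vec_of)

lemma bounded_linear_vec_of: "bounded_linear vec_of"
  unfolding linear_conv_bounded_linear[symmetric]
  by (rule linearI) (simp_all add: vec_eq_iff forall_2)

lemma bounded_linear_pair_of: "bounded_linear pair_of"
  unfolding linear_conv_bounded_linear[symmetric]
  by (rule linearI) (simp_all add: pair_of_def)

lemma borel_measurable_pair_of [measurable]: "pair_of \<in> borel_measurable borel"
  by (intro borel_measurable_continuous_onI linear_continuous_on bounded_linear_pair_of)

lemma borel_measurable_vec_of [measurable]: "vec_of \<in> borel_measurable borel"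
  by (intro borel_measurable_continuous_onI linear_continuous_on bounded_linear_vec_of)

text \<open>A box is pulled back to the box with the same sides.\<close>

lemma lborel_pair_of: "(lborel :: (real \<times> real) measure) = distr lborel borel pair_of"
proof (rule lborel_eqI)
  fix l u :: "real \<times> real"
  assume le: "\<And>b. b \<in> Basis \<Longrightarrow> l \<bullet> b \<le> u \<bullet> b"
  obtain a b where l: "l = (a, b)" by (cases l)
  obtain c d where u: "u = (c, d)" by (cases u)
  from le[of "(1,0)"] le[of "(0,1)"] have le: "a \<le> c" "b \<le> d"
    by (auto simp: Basis_prod_def l u)
  have [simp]: "(1::real, 0::real) \<noteq> (0, 1)" by simp
  have B: "(Basis :: (real^2) set) = {axis 1 1, axis 2 1}"
    by (auto simp: Basis_vec_def UNIV_2)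
  have ne: "axis 1 1 \<noteq> (axis 2 1 :: real^2)"
    by (simp add: axis_eq_axis)
  have "pair_of -` box l u = box (vec_of l) (vec_of u)"
    by (auto simp: l u pair_of_def box_def B inner_axis Basis_prod_def)
  moreover have "emeasure lborel (box (vec_of l) (vec_of u)) = (\<Prod>b\<in>Basis. (u - l) \<bullet> b)"
    by (subst emeasure_lborel_box)
       (use le in \<open>auto simp: l u B inner_axis Basis_prod_def ne axis_eq_axis\<close>)
  ultimately show "emeasure (distr lborel borel pair_of) (box l u) = (\<Prod>b\<in>Basis. (u - l) \<bullet> b)"
    by (simp add: emeasure_distr)
qed simp

lemma lborel_vec_of: "(lborel :: (real^2) measure) = distr lborel borel vec_of"
proof -
  have "distr (distr lborel borel pair_of) borel vec_of = distr lborel borel (vec_of \<circ> pair_of)"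
    by (rule distr_distr) auto
  also have "vec_of \<circ> pair_of = id" by (simp add: fun_eq_iff)
  also have "distr (lborel :: (real^2) measure) borel id = lborel"
    unfolding id_def by (rule distr_id2) simp
  finally show ?thesis by (simp flip: lborel_pair_of)
qed

text \<open>
  The change of variables theorem with the constant integrand \<open>1\<close>. The target is \<open>real^2\<close> and the source
  \<open>real \<times> real\<close>: then only the Borel set \<open>S\<close> has to be transported, not its image, for which the change of
  variables theorem yields Lebesgue measurability only. Boundedness of the image makes its area finite, so that the integral of the
  Jacobian exists.
\<close>

lemma area_of_injective_image:
  fixes F :: "real \<times> real \<Rightarrow> real^2"
  assumes S: "S \<in> sets borel"
    and der: "\<And>u. u \<in> S \<Longrightarrow> (F has_derivative F' u) (at u)"
    and inj: "inj_on F S"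
    and bdd: "bounded (F ` S)"
    and meas: "set_borel_measurable borel S (\<lambda>u. det2 (F' u (1, 0)) (F' u (0, 1)))"
  shows "F ` S \<in> sets lebesgue"
    and "(\<integral>\<^sup>+u\<in>S. ennreal \<bar>det2 (F' u (1, 0)) (F' u (0, 1))\<bar> \<partial>lborel)
          = emeasure lebesgue (F ` S)"
proof -
  define S2 where "S2 = pair_of -` S"
  define G where "G = F \<circ> pair_of"
  define G' where "G' v = F' (pair_of v) \<circ> pair_of" for v
  have S2: "S2 \<in> sets borel"
    unfolding S2_def using measurable_sets[OF borel_measurable_pair_of S] by simp
  have img: "pair_of ` S2 = S"
    unfolding S2_def by (auto simp: image_iff) (metis pair_of_vec_of)
  have GS: "G ` S2 = F ` S" unfolding G_def image_comp[symmetric] img ..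
  have derG: "(G has_derivative G' v) (at v within S2)" if "v \<in> S2" for v
    unfolding G_def G'_def
    by (rule diff_chain_within[OF bounded_linear_imp_has_derivative[OF bounded_linear_pair_of]])
       (use that der[of "pair_of v"] in \<open>auto simp: S2_def intro: has_derivative_at_withinI\<close>)
  have injG: "inj_on G S2"
    unfolding G_def
    by (rule comp_inj_on)
       (use inj in \<open>auto simp: img intro: inj_on_inverseI[where g=vec_of]\<close>)
  have S2L: "S2 \<in> sets lebesgue" using S2 by auto
  have "G ` S2 \<in> sets lebesgue"
    using derG by (intro differentiable_image_in_sets_lebesgue S2L)
      (auto simp: differentiable_on_def differentiable_def)
  then show FS: "F ` S \<in> sets lebesgue" by (simp add: GS)
  then have lm: "G ` S2 \<in> lmeasurable"
    using bdd by (simp add: GS bounded_set_imp_lmeasurable)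
  have det: "det (matrix (G' v)) = det2 (F' (pair_of v) (1, 0)) (F' (pair_of v) (0, 1))" for v
  proof -
    have "pair_of (axis 1 1) = (1, 0)" "pair_of (axis 2 1) = (0, 1)"
      by (simp_all add: pair_of_def axis_def)
    then show ?thesis by (simp add: det_2 matrix_def det2_def G'_def)
  qed
  have "((\<lambda>v. \<bar>det (matrix (G' v))\<bar>) has_integral measure lebesgue (G ` S2)) S2"
    using has_measure_differentiable_image[OF S2L derG injG] lm by blast
  from nn_integral_has_integral_lebesgue'[OF _ this]
  have "(\<integral>\<^sup>+v\<in>S2. ennreal \<bar>det (matrix (G' v))\<bar> \<partial>lborel) = emeasure lebesgue (F ` S)"
    using emeasure_eq_measure2[OF lm] by (simp add: GS)
  moreover have "(\<integral>\<^sup>+u\<in>S. ennreal \<bar>det2 (F' u (1, 0)) (F' u (0, 1))\<bar> \<partial>lborel)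
     = (\<integral>\<^sup>+v\<in>S2. ennreal \<bar>det (matrix (G' v))\<bar> \<partial>lborel)"
  proof -
    have eq: "(\<integral>\<^sup>+u. g u \<partial>lborel) = (\<integral>\<^sup>+v. g (pair_of v) \<partial>lborel)"
      if "g \<in> borel_measurable borel" for g :: "real \<times> real \<Rightarrow> ennreal"
      by (subst lborel_pair_of, subst nn_integral_distr) (use that in auto)
    have "(\<lambda>u. ennreal \<bar>indicator S u *\<^sub>R det2 (F' u (1, 0)) (F' u (0, 1))\<bar>) \<in> borel_measurable borel"
      using meas unfolding set_borel_measurable_def by measurable
    also have "(\<lambda>u. ennreal \<bar>indicator S u *\<^sub>R det2 (F' u (1, 0)) (F' u (0, 1))\<bar>)
       = (\<lambda>u. ennreal \<bar>det2 (F' u (1, 0)) (F' u (0, 1))\<bar> * indicator S u)"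
      by (auto simp: fun_eq_iff indicator_def)
    finally show ?thesis
      by (subst eq) (simp_all add: det S2_def indicator_def)
  qed
  ultimately show "(\<integral>\<^sup>+u\<in>S. ennreal \<bar>det2 (F' u (1, 0)) (F' u (0, 1))\<bar> \<partial>lborel)
          = emeasure lebesgue (F ` S)" by simp
qed

lemma nn_integral_pair:
  fixes g :: "'a::euclidean_space \<times> 'b::euclidean_space \<Rightarrow> ennreal"
  assumes "g \<in> borel_measurable borel"
  shows "(\<integral>\<^sup>+z. g z \<partial>lborel) = (\<integral>\<^sup>+x. \<integral>\<^sup>+y. g (x, y) \<partial>lborel \<partial>lborel)"
  using lborel.nn_integral_fst[of g lborel] assms by (simp add: lborel_prod)

lemma emeasure_plane:
  assumes "S \<in> sets borel"
  shows "emeasure lborel S = (\<integral>\<^sup>+p. \<integral>\<^sup>+t. indicator S (vec_of (p, t)) \<partial>lborel \<partial>lborel)"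
proof -
  have [measurable]: "S \<in> sets borel" by fact
  have "emeasure lborel S = (\<integral>\<^sup>+z. indicator S z \<partial>lborel)" by simp
  also have "\<dots> = (\<integral>\<^sup>+z. indicator S (vec_of z) \<partial>lborel)"
    by (subst lborel_vec_of, subst nn_integral_distr) simp_all
  also have "\<dots> = (\<integral>\<^sup>+p. \<integral>\<^sup>+t. indicator S (vec_of (p, t)) \<partial>lborel \<partial>lborel)"
    by (rule nn_integral_pair) measurable
  finally show ?thesis .
qed

section \<open>The mean of a sinusoid over all directions\<close>

text \<open>
  On \<open>[0, 2 * pi]\<close> the sine of \<open>\<theta> - \<phi>\<close> changes sign exactly at \<open>\<phi>\<close> and \<open>\<phi> + pi\<close>; on the three pieces
  the integrals are \<open>1 - cos \<phi>\<close>, \<open>2\<close> and \<open>1 + cos \<phi>\<close>.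
\<close>

lemma has_integral_abs_sin_shift:
  assumes "0 \<le> \<phi>" "\<phi> \<le> pi"
  shows "((\<lambda>\<theta>. \<bar>sin (\<theta> - \<phi>)\<bar>) has_integral 4) {0..2 * pi}"
proof -
  have up: "((\<lambda>\<theta>. sin (\<theta> - \<phi>)) has_integral (- cos (b - \<phi>) - - cos (a - \<phi>))) {a..b}"
    if "a \<le> b" for a b :: real
    using that
    by (intro fundamental_theorem_of_calculus)
       (auto intro!: derivative_eq_intros simp flip: has_real_derivative_iff_has_vector_derivative)
  have I1: "((\<lambda>\<theta>. \<bar>sin (\<theta> - \<phi>)\<bar>) has_integral 1 - cos \<phi>) {0..\<phi>}"
  proof (rule has_integral_eq)
    show "((\<lambda>\<theta>. - sin (\<theta> - \<phi>)) has_integral 1 - cos \<phi>) {0..\<phi>}"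
      using has_integral_neg[OF up[of 0 \<phi>]] assms by simp
    show "- sin (x - \<phi>) = \<bar>sin (x - \<phi>)\<bar>" if "x \<in> {0..\<phi>}" for x
      using sin_ge_zero[of "\<phi> - x"] that assms sin_minus[of "\<phi> - x"] by simp
  qed
  have I2: "((\<lambda>\<theta>. \<bar>sin (\<theta> - \<phi>)\<bar>) has_integral 2) {\<phi>..\<phi> + pi}"
  proof (rule has_integral_eq)
    show "((\<lambda>\<theta>. sin (\<theta> - \<phi>)) has_integral 2) {\<phi>..\<phi> + pi}"
      using up[of \<phi> "\<phi> + pi"] by simp
    show "sin (x - \<phi>) = \<bar>sin (x - \<phi>)\<bar>" if "x \<in> {\<phi>..\<phi> + pi}" for x
      using sin_ge_zero[of "x - \<phi>"] that by simp
  qed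
  have I3: "((\<lambda>\<theta>. \<bar>sin (\<theta> - \<phi>)\<bar>) has_integral cos \<phi> + 1) {\<phi> + pi..2 * pi}"
  proof (rule has_integral_eq)
    show "((\<lambda>\<theta>. - sin (\<theta> - \<phi>)) has_integral cos \<phi> + 1) {\<phi> + pi..2 * pi}"
      using has_integral_neg[OF up[of "\<phi> + pi" "2 * pi"]] assms
      by (simp add: cos_diff add.commute)
    show "- sin (x - \<phi>) = \<bar>sin (x - \<phi>)\<bar>" if "x \<in> {\<phi> + pi..2 * pi}" for x
      using sin_ge_zero[of "x - \<phi> - pi"] that assms sin_minus_pi[of "x - \<phi>"] by simp
  qed
  have "((\<lambda>\<theta>. \<bar>sin (\<theta> - \<phi>)\<bar>) has_integral (1 - cos \<phi> + 2)) {0..\<phi> + pi}"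
    using assms by (intro has_integral_combine[OF _ _ I1 I2]) auto
  from has_integral_combine[OF _ _ this I3] show ?thesis
    using assms by simp
qed

text \<open>Up to sign, the integrand is $R\,|\sin(\theta-\varphi)|$ with $R = \sqrt{A^2+B^2}$.\<close>

lemma nn_integral_abs_sinusoid:
  "(\<integral>\<^sup>+\<theta>\<in>{0..<2 * pi}. ennreal \<bar>A * sin \<theta> - B * cos \<theta>\<bar> \<partial>lborel)
     = ennreal (4 * sqrt (A\<^sup>2 + B\<^sup>2))"
proof -
  define R where "R = sqrt (A\<^sup>2 + B\<^sup>2)"
  have "\<exists>\<phi>. 0 \<le> \<phi> \<and> \<phi> \<le> pi \<and> (\<forall>\<theta>. \<bar>A * sin \<theta> - B * cos \<theta>\<bar> = R * \<bar>sin (\<theta> - \<phi>)\<bar>)"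
  proof (cases "R = 0")
    case True
    then have "A = 0 \<and> B = 0" by (simp add: R_def sum_power2_eq_zero_iff)
    then show ?thesis by (intro exI[of _ 0]) (simp add: True)
  next
    case False
    then have R: "R > 0" by (simp add: R_def order.not_eq_order_implies_strict)
    have R2: "R\<^sup>2 = A\<^sup>2 + B\<^sup>2" by (simp add: R_def)
    \<comment> \<open>The sign makes the sine of \<open>\<phi>\<close> nonnegative, so that \<open>\<phi>\<close> can be taken in \<open>[0, pi]\<close>.\<close>
    define \<epsilon> :: real where "\<epsilon> = (if B \<ge> 0 then 1 else - 1)"
    have \<epsilon>: "\<epsilon> * \<epsilon> = 1" "\<bar>\<epsilon>\<bar> = 1" by (auto simp: \<epsilon>_def)
    have "(\<epsilon> * A / R)\<^sup>2 + (\<epsilon> * B / R)\<^sup>2 = 1"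
    proof -
      have "(\<epsilon> * A / R)\<^sup>2 + (\<epsilon> * B / R)\<^sup>2 = (\<epsilon> * \<epsilon>) * (A\<^sup>2 + B\<^sup>2) / R\<^sup>2"
        by (simp add: power_divide power2_eq_square algebra_simps add_divide_distrib)
      then show ?thesis using R by (simp add: \<epsilon> flip: R2)
    qed
    moreover have "0 \<le> \<epsilon> * B / R" using R by (auto simp: \<epsilon>_def divide_simps)
    ultimately obtain \<phi> where \<phi>: "0 \<le> \<phi>" "\<phi> \<le> pi" "\<epsilon> * A / R = cos \<phi>" "\<epsilon> * B / R = sin \<phi>"
      using sincos_total_pi[of "\<epsilon> * B / R" "\<epsilon> * A / R"] by auto
    have "A * sin \<theta> - B * cos \<theta> = \<epsilon> * R * sin (\<theta> - \<phi>)" for \<theta>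
    proof -
      have "\<epsilon> * R * sin (\<theta> - \<phi>) = (\<epsilon> * \<epsilon>) * (A * sin \<theta> - B * cos \<theta>)"
        unfolding sin_diff \<phi>(3,4)[symmetric] using R by (simp add: field_simps)
      then show ?thesis by (simp add: \<epsilon>)
    qed
    then show ?thesis using \<phi>(1,2) \<epsilon> R by (intro exI[of _ \<phi>]) (auto simp: abs_mult)
  qed
  then obtain \<phi> where \<phi>: "0 \<le> \<phi>" "\<phi> \<le> pi" "\<And>\<theta>. \<bar>A * sin \<theta> - B * cos \<theta>\<bar> = R * \<bar>sin (\<theta> - \<phi>)\<bar>"
    by blast
  have "((\<lambda>\<theta>. \<bar>A * sin \<theta> - B * cos \<theta>\<bar>) has_integral R * 4) {0..2 * pi}"
    unfolding \<phi>(3) by (intro has_integral_mult_right has_integral_abs_sin_shift \<phi>)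
  from nn_integral_has_integral_lebesgue'[OF _ this]
  have "(\<integral>\<^sup>+\<theta>\<in>{0..2 * pi}. ennreal \<bar>A * sin \<theta> - B * cos \<theta>\<bar> \<partial>lborel) = ennreal (R * 4)"
    by simp
  moreover have "AE \<theta> in lborel. \<theta> \<noteq> 2 * pi" by (rule AE_lborel_singleton)
  then have "(\<integral>\<^sup>+\<theta>\<in>{0..2 * pi}. ennreal \<bar>A * sin \<theta> - B * cos \<theta>\<bar> \<partial>lborel)
    = (\<integral>\<^sup>+\<theta>\<in>{0..<2 * pi}. ennreal \<bar>A * sin \<theta> - B * cos \<theta>\<bar> \<partial>lborel)"
    by (intro nn_integral_cong_AE) (auto simp: indicator_def)
  ultimately show ?thesis by (simp add: R_def mult.commute)
qed

section \<open>Vectors orthogonal to a surface\<close>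

definition cross :: "heis \<Rightarrow> heis \<Rightarrow> heis" where
  "cross = (\<lambda>(a, b, c) (a', b', c'). (b * c' - c * b', c * a' - a * c', a * b' - b * a'))"

lemma inner_heis: "(a, b, c) \<bullet> (a', b', c') = a * a' + b * b' + c * (c' :: real)" for a b c :: real
  by simp

text \<open>The coefficients come from the expansion of \<open>z\<close> in the basis \<open>v\<close>, \<open>w\<close>, \<open>v \<times> w\<close> by Cramer's rule.\<close>

lemma orthogonal_complement_cross:
  assumes "cross v w \<noteq> 0" "z \<bullet> cross v w = 0"
  shows "\<exists>\<alpha> \<beta>. z = \<alpha> *\<^sub>R v + \<beta> *\<^sub>R w"
proof -
  define n where "n = cross v w"
  have nn: "n \<bullet> n \<noteq> 0" using assms by (simp add: n_def)
  have "(n \<bullet> n) *\<^sub>R z = (n \<bullet> cross z w) *\<^sub>R v + (n \<bullet> cross v z) *\<^sub>R w + (z \<bullet> n) *\<^sub>R n"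
    unfolding n_def by (cases v; cases w; cases z) (simp add: cross_def algebra_simps)
  then have "(n \<bullet> n) *\<^sub>R z = (n \<bullet> cross z w) *\<^sub>R v + (n \<bullet> cross v z) *\<^sub>R w"
    using assms by (simp add: n_def)
  moreover have "z = inverse (n \<bullet> n) *\<^sub>R ((n \<bullet> n) *\<^sub>R z)" using nn by simp
  ultimately have "z = (inverse (n \<bullet> n) * (n \<bullet> cross z w)) *\<^sub>R v
      + (inverse (n \<bullet> n) * (n \<bullet> cross v z)) *\<^sub>R w"
    by (metis scaleR_add_right scaleR_scaleR)
  then show ?thesis by blast
qed

text \<open>The number \<open>z \<bullet> cross v w\<close> is the determinant of three vectors that all lie in the plane orthogonal to \<open>a\<close>.\<close>

lemma coplanar_determinant_zero:
  assumes "v \<bullet> a = 0" "w \<bullet> a = 0" "z \<bullet> a = 0" "a \<noteq> 0"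
  shows "z \<bullet> cross v w = 0"
proof -
  have "(z \<bullet> cross v w) *\<^sub>R a = (v \<bullet> a) *\<^sub>R cross w z + (w \<bullet> a) *\<^sub>R cross z v + (z \<bullet> a) *\<^sub>R cross v w"
    by (cases v; cases w; cases z; cases a) (simp add: cross_def algebra_simps)
  then show ?thesis using assms by simp
qed

lemma cross_nonzero_if_inj:
  fixes f :: "real \<times> real \<Rightarrow> heis"
  assumes "linear f" "inj f"
  shows "cross (f (1, 0)) (f (0, 1)) \<noteq> 0"
proof
  assume 0: "cross (f (1, 0)) (f (0, 1)) = 0"
  define v w where "v = f (1, 0)" "w = f (0, 1)"
  have f: "f (\<alpha>, \<beta>) = \<alpha> *\<^sub>R v + \<beta> *\<^sub>R w" for \<alpha> \<beta>
  proof -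
    have "f (\<alpha>, \<beta>) = f (\<alpha> *\<^sub>R (1, 0) + \<beta> *\<^sub>R (0, 1))" by simp
    also have "\<dots> = \<alpha> *\<^sub>R v + \<beta> *\<^sub>R w"
      unfolding linear_add[OF assms(1)] linear_scale[OF assms(1)] v_w_def ..
    finally show ?thesis .
  qed
  \<comment> \<open>As \<open>v \<times> w = 0\<close>, expanding \<open>v \<times> (v \<times> w)\<close> gives a linear relation between \<open>v\<close> and \<open>w\<close>.\<close>
  have "(v \<bullet> w) *\<^sub>R v - (v \<bullet> v) *\<^sub>R w = cross v (cross v w)"
    by (cases v; cases w) (simp add: cross_def algebra_simps)
  also have "\<dots> = 0" using 0 by (cases v) (simp add: v_w_def cross_def zero_prod_def)
  finally have "f (v \<bullet> w, - (v \<bullet> v)) = f (0, 0)" by (simp add: f)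
  then have "(v \<bullet> w, - (v \<bullet> v)) = (0, 0)" using assms(2) by (rule injD[rotated])
  then have "v = 0" by simp
  then have "f (1, 0) = f (0, 0)" by (simp add: f)
  then show False using assms(2) by (auto dest: injD)
qed

section \<open>The p-area density\<close>

lemma mem_xi: "z \<in> xi q \<longleftrightarrow> Theta q z = 0"
proof -
  obtain x y t where q: "q = (x, y, t)" by (cases q)
  obtain a b c where z: "z = (a, b, c)" by (cases z)
  have "z \<in> xi q \<longleftrightarrow> (\<exists>\<alpha> \<beta>. z - \<alpha> *\<^sub>R std_e1 q = \<beta> *\<^sub>R std_e2 q)"
    unfolding xi_def span_breakdown_eq span_singleton by auto
  also have "\<dots> \<longleftrightarrow> Theta q z = 0"
    by (auto simp: q z std_e1_def std_e2_def Theta_def algebra_simps)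
  finally show ?thesis .
qed

text \<open>
  At a regular point write \<open>e1 = \<alpha> * std_e1 + \<beta> * std_e2\<close> with $\alpha^2+\beta^2 = 1$. Then
  \<open>omega1 = \<alpha> * dx + \<beta> * dy\<close>, and evaluating \<open>Theta \<and> omega1\<close> on \<open>v\<close>, \<open>w\<close> gives \<open>\<alpha> * B - \<beta> * A\<close>, where \<open>A\<close>, \<open>B\<close> are
  the components of \<open>v \<times> w\<close> along the standard frame. As \<open>e1\<close> is tangent, \<open>\<alpha> * A + \<beta> * B = 0\<close>, so
  \<open>(A, B)\<close> is \<open>\<plusminus>\<close> its length times \<open>(- \<beta>, \<alpha>)\<close>. At a singular point \<open>A = B = 0\<close>, which is why the formula
  needs no case distinction.
\<close>

lemma p_area_density_eq:
  assumes T: "tangent_space \<Sigma> q = {z. z \<bullet> cross v w = 0}" and n0: "cross v w \<noteq> 0"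
  shows "p_area_density \<Sigma> q v w
     = sqrt ((std_e1 q \<bullet> cross v w)\<^sup>2 + (std_e2 q \<bullet> cross v w)\<^sup>2)"
proof -
  obtain x y t where q: "q = (x, y, t)" by (cases q)
  obtain n1 n2 n3 where n: "cross v w = (n1, n2, n3)" by (cases "cross v w")
  define A B where "A = std_e1 q \<bullet> cross v w" "B = std_e2 q \<bullet> cross v w"
  have A: "A = n1 + y * n3" and B: "B = n2 - x * n3"
    by (simp_all add: A_B_def q n std_e1_def std_e2_def)
  have hor: "\<alpha> *\<^sub>R std_e1 q + \<beta> *\<^sub>R std_e2 q \<in> xi q" for \<alpha> \<beta>
    unfolding mem_xi by (simp add: q std_e1_def std_e2_def Theta_def algebra_simps)
  show ?thesis
  proof (cases "singular_point \<Sigma> q")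
    case True
    then have "std_e1 q \<in> tangent_space \<Sigma> q" "std_e2 q \<in> tangent_space \<Sigma> q"
      using hor[of 1 0] hor[of 0 1] by (auto simp: singular_point_def)
    then show ?thesis using True by (simp add: p_area_density_def T)
  next
    case False
    have AB: "A\<^sup>2 + B\<^sup>2 \<noteq> 0"
    proof
      assume "A\<^sup>2 + B\<^sup>2 = 0"
      then have n12: "n1 = - y * n3" "n2 = x * n3"
        using A B by (auto simp: sum_power2_eq_zero_iff)
      with n0 have n3: "n3 \<noteq> 0" by (auto simp: n zero_prod_def)
      have "z \<bullet> cross v w = n3 * Theta q z" for z
        by (cases z) (simp add: n n12 q Theta_def algebra_simps)
      with n3 have "z \<bullet> cross v w = 0 \<longleftrightarrow> Theta q z = 0" for z by simp
      then have "singular_point \<Sigma> q" by (auto simp: singular_point_def T mem_xi)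
      with False show False by simp
    qed
    define R where "R = sqrt (A\<^sup>2 + B\<^sup>2)"
    have R2: "R\<^sup>2 = A\<^sup>2 + B\<^sup>2" and R: "R \<noteq> 0" using AB by (auto simp: R_def)
    have tang: "\<alpha> *\<^sub>R std_e1 q + \<beta> *\<^sub>R std_e2 q \<in> tangent_space \<Sigma> q \<longleftrightarrow> \<alpha> * A + \<beta> * B = 0" for \<alpha> \<beta>
      by (simp add: T A_B_def inner_add_left)
    have norm: "levi_norm (\<alpha> *\<^sub>R std_e1 q + \<beta> *\<^sub>R std_e2 q) = sqrt (\<alpha>\<^sup>2 + \<beta>\<^sup>2)" for \<alpha> \<beta>
      by (simp add: levi_norm_def levi_inner_def q std_e1_def std_e2_def power2_eq_square)
    \<comment> \<open>\<open>e1\<close> is a choice, so a unit vector in the tangent plane and \<open>xi\<close> has to be exhibited.\<close>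
    have "\<exists>e. e \<in> xi q \<inter> tangent_space \<Sigma> q \<and> levi_norm e = 1"
    proof (intro exI conjI)
      let ?e = "(- B / R) *\<^sub>R std_e1 q + (A / R) *\<^sub>R std_e2 q"
      show "?e \<in> xi q \<inter> tangent_space \<Sigma> q"
        using hor[of "- B / R" "A / R"] tang[of "- B / R" "A / R"] by (simp add: mult.commute)
      have "(- B / R)\<^sup>2 + (A / R)\<^sup>2 = 1"
      proof -
        have "(- B / R)\<^sup>2 + (A / R)\<^sup>2 = (A\<^sup>2 + B\<^sup>2) / R\<^sup>2"
          by (simp add: power_divide add_divide_distrib)
        then show ?thesis using R by (simp flip: R2)
      qed
      then show "levi_norm ?e = 1" unfolding norm by simp
    qed
    then have e: "e1 \<Sigma> q \<in> xi q \<inter> tangent_space \<Sigma> q \<and> levi_norm (e1 \<Sigma> q) = 1"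
      unfolding e1_def by (rule someI_ex)
    obtain \<alpha> \<beta> \<gamma> where e1: "e1 \<Sigma> q = (\<alpha>, \<beta>, \<gamma>)" by (cases "e1 \<Sigma> q")
    have "Theta q (\<alpha>, \<beta>, \<gamma>) = 0"
      using e by (simp add: mem_xi flip: e1)
    then have \<gamma>: "\<gamma> = \<alpha> * y - \<beta> * x" by (simp add: q Theta_def mult.commute)
    have e1': "e1 \<Sigma> q = \<alpha> *\<^sub>R std_e1 q + \<beta> *\<^sub>R std_e2 q"
      unfolding e1 \<gamma> by (simp add: q std_e1_def std_e2_def)
    have unit: "\<alpha>\<^sup>2 + \<beta>\<^sup>2 = 1" using e unfolding e1' norm by simp
    have orth: "\<alpha> * A + \<beta> * B = 0" using e tang[of \<alpha> \<beta>] unfolding e1' by simp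
    have e2: "e2 \<Sigma> q = (- \<beta>, \<alpha>, - \<alpha> * x - \<beta> * y)"
      unfolding e2_def e1 by (simp add: J_def q std_e1_def std_e2_def algebra_simps)
    have om: "omega1 \<Sigma> q (a, b, c) = \<alpha> * a + \<beta> * b" for a b c
      unfolding omega1_def
    proof (rule the_equality)
      let ?a = "\<alpha> * a + \<beta> * b" and ?b = "\<alpha> * b - \<beta> * a"
      have "a = (\<alpha>\<^sup>2 + \<beta>\<^sup>2) * a" "b = (\<alpha>\<^sup>2 + \<beta>\<^sup>2) * b" by (simp_all add: unit)
      then have "a = ?a * \<alpha> - ?b * \<beta>" "b = ?a * \<beta> + ?b * \<alpha>"
        by (simp_all add: power2_eq_square algebra_simps)
      then have "(a, b, c) = ?a *\<^sub>R e1 \<Sigma> q + ?b *\<^sub>R e2 \<Sigma> q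
          + (c - ?a * \<gamma> + ?b * (\<alpha> * x + \<beta> * y)) *\<^sub>R T_field"
        by (simp add: e1 e2 T_field_def algebra_simps)
      then show "\<exists>b' c'. (a, b, c) = ?a *\<^sub>R e1 \<Sigma> q + b' *\<^sub>R e2 \<Sigma> q + c' *\<^sub>R T_field" by blast
    next
      fix a' assume "\<exists>b' c'. (a, b, c) = a' *\<^sub>R e1 \<Sigma> q + b' *\<^sub>R e2 \<Sigma> q + c' *\<^sub>R T_field"
      then obtain b' where "a = a' * \<alpha> - b' * \<beta>" "b = a' * \<beta> + b' * \<alpha>"
        by (auto simp: e1 e2 T_field_def)
      then have "\<alpha> * a + \<beta> * b = a' * (\<alpha>\<^sup>2 + \<beta>\<^sup>2)" by algebra
      then show "a' = \<alpha> * a + \<beta> * b" by (simp add: unit)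
    qed
    obtain v1 v2 v3 w1 w2 w3 where v: "v = (v1, v2, v3)" and w: "w = (w1, w2, w3)"
      by (cases v; cases w)
    have n': "n1 = v2 * w3 - v3 * w2" "n2 = v3 * w1 - v1 * w3" "n3 = v1 * w2 - v2 * w1"
      using n by (auto simp: cross_def v w)
    have "Theta q v * omega1 \<Sigma> q w - Theta q w * omega1 \<Sigma> q v = \<alpha> * B - \<beta> * A"
      unfolding v w om by (simp add: Theta_def q A B n' algebra_simps)
    then have dens: "p_area_density \<Sigma> q v w = \<bar>\<alpha> * B - \<beta> * A\<bar>"
      using False by (simp add: p_area_density_def)
    have "(\<alpha> * B - \<beta> * A)\<^sup>2 + (\<alpha> * A + \<beta> * B)\<^sup>2 = (\<alpha>\<^sup>2 + \<beta>\<^sup>2) * (A\<^sup>2 + B\<^sup>2)"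
      by algebra
    then have "(\<alpha> * B - \<beta> * A)\<^sup>2 = A\<^sup>2 + B\<^sup>2" by (simp add: orth unit)
    then have "\<bar>\<alpha> * B - \<beta> * A\<bar> = sqrt (A\<^sup>2 + B\<^sup>2)" by (metis real_sqrt_abs)
    then show ?thesis by (simp add: dens A_B_def)
  qed
qed

section \<open>Horizontal lines of a fixed direction\<close>

text \<open>
  The common velocity of the horizontal lines \<open>hline (p, \<theta>, t)\<close>; it is constant along each of them
  (\<open>hdir_along_line\<close>).
\<close>

definition hdir :: "real \<Rightarrow> heis \<Rightarrow> heis" where
  "hdir \<theta> q = sin \<theta> *\<^sub>R std_e1 q - cos \<theta> *\<^sub>R std_e2 q"

text \<open>
  The parameters \<open>(p, t)\<close> of the horizontal line of direction \<open>\<theta>\<close> through a point. Its arc length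
  parameter there is \<open>s = x * sin \<theta> - y * cos \<theta>\<close>.
\<close>

definition hproj :: "real \<Rightarrow> heis \<Rightarrow> real^2" where
  "hproj \<theta> = (\<lambda>(x, y, t). vec_of (x * cos \<theta> + y * sin \<theta>,
      t - (x * sin \<theta> - y * cos \<theta>) * (x * cos \<theta> + y * sin \<theta>)))"

lemma hdir_coords:
  "hdir \<theta> (x, y, t) = (sin \<theta>, - cos \<theta>, x * cos \<theta> + y * sin \<theta>)"
  by (simp add: hdir_def std_e1_def std_e2_def)

lemma sin_cos_products: "sin \<theta> * sin \<theta> + cos \<theta> * cos \<theta> = 1" for \<theta> :: real
  by (simp flip: power2_eq_square)

lemma hproj_hline: "hproj \<theta> (hline (p, \<theta>, t) s) = vec_of (p, t)"
proof -
  note sc = sin_cos_products[of \<theta>]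
  have "(p * cos \<theta> + s * sin \<theta>) * cos \<theta> + (p * sin \<theta> - s * cos \<theta>) * sin \<theta> = p"
    using sc by algebra
  moreover have "(p * cos \<theta> + s * sin \<theta>) * sin \<theta> - (p * sin \<theta> - s * cos \<theta>) * cos \<theta> = s"
    using sc by algebra
  ultimately show ?thesis by (simp add: hproj_def hline_def)
qed

lemma on_hline:
  assumes "hproj \<theta> q = vec_of (p, t)"
  shows "\<exists>s. q = hline (p, \<theta>, t) s"
proof -
  obtain x y z where q: "q = (x, y, z)" by (cases q)
  note sc = sin_cos_products[of \<theta>]
  define s where "s = x * sin \<theta> - y * cos \<theta>"
  have "x * cos \<theta> + y * sin \<theta> = p" "z - s * p = t"
    using assms by (auto simp: q hproj_def s_def)
  moreover have "x = (x * cos \<theta> + y * sin \<theta>) * cos \<theta> + s * sin \<theta>"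
    "y = (x * cos \<theta> + y * sin \<theta>) * sin \<theta> - s * cos \<theta>"
    unfolding s_def using sc by algebra+
  ultimately show ?thesis by (intro exI[of _ s]) (auto simp: q hline_def)
qed

lemma hline_add: "hline (p, \<theta>, t) (s + a) = hline (p, \<theta>, t) s + a *\<^sub>R hdir \<theta> (hline (p, \<theta>, t) s)"
proof -
  have "(p * cos \<theta> + s * sin \<theta>) * cos \<theta> + (p * sin \<theta> - s * cos \<theta>) * sin \<theta> = p"
    using sin_cos_products[of \<theta>] by algebra
  then show ?thesis by (simp add: hline_def hdir_coords algebra_simps)
qed

lemma hproj_eq_iff: "hproj \<theta> q = hproj \<theta> q' \<longleftrightarrow> (\<exists>a. q' = q + a *\<^sub>R hdir \<theta> q)"
proof -
  obtain p t where pt: "hproj \<theta> q = vec_of (p, t)"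
    by (metis pair_of_vec_of surj_pair vec_of_pair_of)
  then obtain s where q: "q = hline (p, \<theta>, t) s" using on_hline by blast
  show ?thesis
  proof
    assume "hproj \<theta> q = hproj \<theta> q'"
    then obtain s' where "q' = hline (p, \<theta>, t) s'" using on_hline pt by metis
    then show "\<exists>a. q' = q + a *\<^sub>R hdir \<theta> q"
      using hline_add[of p \<theta> t s "s' - s"] by (auto simp: q)
  next
    assume "\<exists>a. q' = q + a *\<^sub>R hdir \<theta> q"
    then show "hproj \<theta> q = hproj \<theta> q'"
      using hline_add[of p \<theta> t s] hproj_hline by (metis q)
  qed
qed

lemma hdir_along_line: "hdir \<theta> (q + a *\<^sub>R hdir \<theta> q) = hdir \<theta> q"
  by (cases q) (simp add: hdir_coords algebra_simps)

lemma hproj_along_line: "hproj \<theta> (q + a *\<^sub>R hdir \<theta> q) = hproj \<theta> q"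
  using hproj_eq_iff by metis

lemma hdir_nonzero: "hdir \<theta> q \<noteq> 0"
proof (cases q)
  case (fields x y t)
  have "\<not> (sin \<theta> = 0 \<and> cos \<theta> = 0)" using sin_cos_products[of \<theta>] by auto
  then show ?thesis by (auto simp: fields hdir_coords zero_prod_def)
qed

definition hproj_deriv :: "real \<Rightarrow> heis \<Rightarrow> heis \<Rightarrow> real^2" where
  "hproj_deriv \<theta> = (\<lambda>(x, y, t) (dx, dy, dt). vec_of (dx * cos \<theta> + dy * sin \<theta>,
      dt - ((x * sin \<theta> - y * cos \<theta>) * (dx * cos \<theta> + dy * sin \<theta>)
          + (dx * sin \<theta> - dy * cos \<theta>) * (x * cos \<theta> + y * sin \<theta>))))"

lemma has_derivative_hproj: "(hproj \<theta> has_derivative hproj_deriv \<theta> q) (at q)"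
proof -
  have "((\<lambda>q. vec_of (fst q * cos \<theta> + fst (snd q) * sin \<theta>,
      snd (snd q) - (fst q * sin \<theta> - fst (snd q) * cos \<theta>) * (fst q * cos \<theta> + fst (snd q) * sin \<theta>)))
    has_derivative (\<lambda>v. vec_of (fst v * cos \<theta> + fst (snd v) * sin \<theta>,
      snd (snd v) - (((fst q * sin \<theta> - fst (snd q) * cos \<theta>) * (fst v * cos \<theta> + fst (snd v) * sin \<theta>))
       + (fst v * sin \<theta> - fst (snd v) * cos \<theta>) * (fst q * cos \<theta> + fst (snd q) * sin \<theta>)))))
    (at q)"
    by (rule bounded_linear.has_derivative[OF bounded_linear_vec_of])
       (rule derivative_intros has_derivative_fst has_derivative_snd has_derivative_ident
          has_derivative_mult_left)+
  then show ?thesis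
    by (simp add: hproj_def hproj_deriv_def case_prod_unfold)
qed

text \<open>
  The map \<open>hproj \<theta>\<close> collapses the direction \<open>hdir \<theta> q\<close> and preserves volume in the sense that the
  2-form $dp\wedge dt$ pulls back to the contraction of the volume form with \<open>hdir \<theta> q\<close>.
\<close>

lemma det2_hproj_deriv:
  "det2 (hproj_deriv \<theta> q v) (hproj_deriv \<theta> q w) = hdir \<theta> q \<bullet> cross v w"
proof -
  have sc: "sin \<theta> * sin \<theta> + cos \<theta> * cos \<theta> = 1" by (rule sin_cos_products)
  obtain x y t where q: "q = (x, y, t)" by (cases q)
  obtain v1 v2 v3 where v: "v = (v1, v2, v3)" by (cases v)
  obtain w1 w2 w3 where w: "w = (w1, w2, w3)" by (cases w)
  show ?thesis
    unfolding q v w hproj_deriv_def det2_def hdir_coords cross_def prod.case inner_heis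
      vec_of_nth fst_conv snd_conv
    using sc by algebra
qed

lemma continuous_on_hdir [continuous_intros]:
  assumes "continuous_on S f"
  shows "continuous_on S (\<lambda>x. hdir \<theta> (f x))"
proof -
  have "hdir \<theta> q = (sin \<theta>, - cos \<theta>, fst q * cos \<theta> + fst (snd q) * sin \<theta>)" for q
    by (cases q) (simp add: hdir_coords)
  then show ?thesis using assms by (auto intro!: continuous_intros)
qed

lemma continuous_on_std_frame [continuous_intros]:
  assumes "continuous_on S f"
  shows "continuous_on S (\<lambda>x. std_e1 (f x))" "continuous_on S (\<lambda>x. std_e2 (f x))"
  using assms by (auto simp: std_e1_def std_e2_def case_prod_unfold intro!: continuous_intros)

lemma continuous_on_hproj: "continuous_on S (hproj \<theta>)"
  by (meson continuous_at_imp_continuous_on has_derivative_continuous has_derivative_hproj)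

text \<open>
  A line parameter belongs to the image iff some point of the line, at a parameter \<open>s\<close>, lies in \<open>D\<close>; for
  fixed \<open>s\<close> this is an open condition.
\<close>

lemma open_hproj_image:
  assumes "open D"
  shows "open (hproj \<theta> ` D)"
proof -
  have "hproj \<theta> ` D = (\<Union>s. (\<lambda>z :: real^2. hline (z $ 1, \<theta>, z $ 2) s) -` D)"
  proof (intro equalityI subsetI)
    fix z :: "real^2" assume "z \<in> hproj \<theta> ` D"
    then obtain q where q: "q \<in> D" "hproj \<theta> q = vec_of (z $ 1, z $ 2)"
      by (metis imageE pair_of_def vec_of_pair_of)
    then show "z \<in> (\<Union>s. (\<lambda>z :: real^2. hline (z $ 1, \<theta>, z $ 2) s) -` D)"
      using on_hline[OF q(2)] by auto
  next
    fix z :: "real^2" assume "z \<in> (\<Union>s. (\<lambda>z :: real^2. hline (z $ 1, \<theta>, z $ 2) s) -` D)"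
    then obtain s where "hline (z $ 1, \<theta>, z $ 2) s \<in> D" by auto
    moreover have "hproj \<theta> (hline (z $ 1, \<theta>, z $ 2) s) = z"
      by (simp add: hproj_hline vec_eq_iff forall_2)
    ultimately show "z \<in> hproj \<theta> ` D" by (metis imageI)
  qed
  moreover have "open ((\<lambda>z :: real^2. hline (z $ 1, \<theta>, z $ 2) s) -` D)" for s
    by (intro open_vimage assms) (auto simp: hline_def intro!: continuous_intros)
  ultimately show ?thesis by auto
qed

section \<open>Entry and exit points of lines through a convex body\<close>

text \<open>
  The boundary points from which one gets into \<open>D\<close> by moving along the line of direction \<open>\<theta>\<close>: forwards for
  \<open>\<epsilon> = 1\<close> (the entry points) and backwards for \<open>\<epsilon> = - 1\<close> (the exit points).
\<close>

definition line_ends :: "heis set \<Rightarrow> real \<Rightarrow> real \<Rightarrow> heis set" where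
  "line_ends D \<theta> \<epsilon> = {q \<in> frontier D. \<exists>\<tau>>0. q + (\<epsilon> * \<tau>) *\<^sub>R hdir \<theta> q \<in> D}"

text \<open>
  The form in which convexity is used below: a point strictly between a point of the closure and an
  interior point is interior.
\<close>

lemma between_closure_and_open:
  fixes D :: "'a::euclidean_space set"
  assumes "convex D" "open D" "q - b *\<^sub>R h \<in> closure D" "q + \<tau> *\<^sub>R h \<in> D" "b > 0" "\<tau> > 0"
  shows "q \<in> D"
proof (cases "h = 0")
  case False
  have "q = (1 - b / (b + \<tau>)) *\<^sub>R (q - b *\<^sub>R h) + (b / (b + \<tau>)) *\<^sub>R (q + \<tau> *\<^sub>R h)"
  proof -
    have "(1 - b / (b + \<tau>)) *\<^sub>R (q - b *\<^sub>R h) + (b / (b + \<tau>)) *\<^sub>R (q + \<tau> *\<^sub>R h)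
        = q + (b / (b + \<tau>) * \<tau> - (1 - b / (b + \<tau>)) * b) *\<^sub>R h"
      by (simp add: algebra_simps)
    moreover have "b / (b + \<tau>) * \<tau> - (1 - b / (b + \<tau>)) * b = 0"
      using assms by (simp add: field_simps)
    ultimately show ?thesis by simp
  qed
  moreover have "q - b *\<^sub>R h \<noteq> q + \<tau> *\<^sub>R h"
  proof
    assume "q - b *\<^sub>R h = q + \<tau> *\<^sub>R h"
    then have "(b + \<tau>) *\<^sub>R h = 0" by (simp add: algebra_simps)
    then show False using assms False by simp
  qed
  ultimately have "q \<in> open_segment (q - b *\<^sub>R h) (q + \<tau> *\<^sub>R h)"
    unfolding in_segment using assms by (intro conjI exI[of _ "b / (b + \<tau>)"]) auto
  then have "q \<in> open_segment (q + \<tau> *\<^sub>R h) (q - b *\<^sub>R h)" by (simp add: open_segment_commute)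
  moreover have "open_segment (q + \<tau> *\<^sub>R h) (q - b *\<^sub>R h) \<subseteq> interior D"
    using in_interior_closure_convex_segment[OF assms(1)] assms by (simp add: interior_open)
  ultimately show ?thesis using assms by (auto simp: interior_open)
qed (use assms in auto)

text \<open>
  A line has only one entry point: of two of them on the same line, the later one would lie between the
  earlier one and the points of \<open>D\<close> that follow it.
\<close>

lemma inj_on_hproj_line_ends:
  assumes "convex D" "open D" "\<epsilon> \<noteq> 0"
  shows "inj_on (hproj \<theta>) (line_ends D \<theta> \<epsilon>)"
proof (rule inj_onI, rule ccontr)
  fix q q' assume q: "q \<in> line_ends D \<theta> \<epsilon>" and q': "q' \<in> line_ends D \<theta> \<epsilon>"
    and eq: "hproj \<theta> q = hproj \<theta> q'" and ne: "q \<noteq> q'"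
  define h where "h = \<epsilon> *\<^sub>R hdir \<theta> q"
  obtain a where a: "q' = q + a *\<^sub>R hdir \<theta> q" using eq hproj_eq_iff by metis
  define b where "b = a / \<epsilon>"
  have q'h: "q' = q + b *\<^sub>R h" using a assms(3) by (simp add: h_def b_def)
  have "hdir \<theta> q' = hdir \<theta> q" by (simp add: a hdir_along_line)
  then obtain \<tau> \<tau>' where \<tau>: "\<tau> > 0" "q + \<tau> *\<^sub>R h \<in> D" and \<tau>': "\<tau>' > 0" "q' + \<tau>' *\<^sub>R h \<in> D"
    using q q' by (auto simp: line_ends_def h_def mult.commute)
  have cl: "q \<in> closure D" "q' \<in> closure D" "q \<notin> D" "q' \<notin> D"
    using q q' assms(2) by (auto simp: line_ends_def frontier_def interior_open)
  \<comment> \<open>The line is oriented by \<open>h\<close>; whichever of the two points comes second lies in \<open>D\<close>.\<close>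
  show False
  proof (cases "b < 0")
    case True
    then have "q \<in> D"
      by (intro between_closure_and_open[of D q "- b" h \<tau>] assms) (use cl \<tau> q'h in auto)
    with cl show False by simp
  next
    case False
    then have "b > 0" using ne q'h by (cases "b = 0") auto
    then have "q' \<in> D"
      by (intro between_closure_and_open[of D q' "b" h \<tau>'] assms) (use cl \<tau>' q'h in auto)
    with cl show False by simp
  qed
qed

lemma line_ends_disjoint:
  assumes "convex D" "open D"
  shows "line_ends D \<theta> 1 \<inter> line_ends D \<theta> (- 1) = {}"
proof (rule ccontr)
  assume "\<not> ?thesis"
  then obtain q \<tau> \<tau>' where "q \<in> frontier D" and \<tau>: "\<tau> > 0" "q + \<tau> *\<^sub>R hdir \<theta> q \<in> D"
    "\<tau>' > 0" "q - \<tau>' *\<^sub>R hdir \<theta> q \<in> D"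
    by (auto simp: line_ends_def)
  moreover have "q \<in> D"
    using \<tau> closure_subset[of D] by (intro between_closure_and_open[of D q \<tau>' _ \<tau>] assms) auto
  ultimately show False using assms(2) by (simp add: frontier_def interior_open)
qed

text \<open>
  A line that meets the bounded set \<open>D\<close> has an entry and an exit point, since the ray from a point of \<open>D\<close>
  must leave \<open>D\<close>.
\<close>

lemma hproj_line_ends:
  assumes "open D" "bounded D" "\<epsilon> \<noteq> 0"
  shows "hproj \<theta> ` line_ends D \<theta> \<epsilon> = hproj \<theta> ` D"
proof
  show "hproj \<theta> ` line_ends D \<theta> \<epsilon> \<subseteq> hproj \<theta> ` D"
  proof
    fix z assume "z \<in> hproj \<theta> ` line_ends D \<theta> \<epsilon>"
    then obtain q \<tau> where "z = hproj \<theta> q" "q + (\<epsilon> * \<tau>) *\<^sub>R hdir \<theta> q \<in> D"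
      by (auto simp: line_ends_def)
    then show "z \<in> hproj \<theta> ` D" using hproj_along_line by (metis imageI)
  qed
  show "hproj \<theta> ` D \<subseteq> hproj \<theta> ` line_ends D \<theta> \<epsilon>"
  proof
    fix z assume "z \<in> hproj \<theta> ` D"
    then obtain q where q: "q \<in> D" "z = hproj \<theta> q" by auto
    have "q \<in> interior D" "- \<epsilon> *\<^sub>R hdir \<theta> q \<noteq> 0"
      using q assms hdir_nonzero by (auto simp: interior_open)
    from ray_to_frontier[OF \<open>bounded D\<close> this] obtain d
      where d: "d > 0" "q + d *\<^sub>R (- \<epsilon> *\<^sub>R hdir \<theta> q) \<in> frontier D" by blast
    define q' where "q' = q + (- (d * \<epsilon>)) *\<^sub>R hdir \<theta> q"
    have h: "hdir \<theta> q' = hdir \<theta> q" and p: "hproj \<theta> q' = hproj \<theta> q"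
      unfolding q'_def by (rule hdir_along_line hproj_along_line)+
    have "q' \<in> frontier D" using d(2) by (simp add: q'_def)
    moreover have "q' + (\<epsilon> * d) *\<^sub>R hdir \<theta> q' \<in> D"
      unfolding h using q by (simp add: q'_def mult.commute)
    ultimately have "q' \<in> line_ends D \<theta> \<epsilon>" using d(1) by (auto simp: line_ends_def)
    then show "z \<in> hproj \<theta> ` line_ends D \<theta> \<epsilon>" using p q by (metis imageI)
  qed
qed

lemma supporting_hyperplane_containing:
  fixes D C :: "'a::euclidean_space set"
  assumes "convex D" "D \<noteq> {}" "convex C" "C \<inter> D = {}" "q \<in> C" "q \<in> closure D"
  shows "\<exists>a. a \<noteq> 0 \<and> (\<forall>x\<in>closure D. a \<bullet> x \<le> a \<bullet> q) \<and> (\<forall>x\<in>C. a \<bullet> q \<le> a \<bullet> x)"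
proof -
  have "\<exists>a b. a \<noteq> 0 \<and> (\<forall>x\<in>D. a \<bullet> x \<le> b) \<and> (\<forall>x\<in>C. b \<le> a \<bullet> x)"
    using assms by (intro separating_hyperplane_sets) auto
  then obtain a b where a: "a \<noteq> 0" "\<And>x. x \<in> D \<Longrightarrow> a \<bullet> x \<le> b" "\<And>x. x \<in> C \<Longrightarrow> b \<le> a \<bullet> x"
    by blast
  have "closure D \<subseteq> {x. a \<bullet> x \<le> b}"
    using a by (intro closure_minimal closed_halfspace_le) auto
  with a assms(5,6) have "a \<bullet> q = b" by (force intro: antisym)
  with a \<open>closure D \<subseteq> _\<close> show ?thesis by (intro exI[of _ a]) auto
qed

section \<open>Charts of the boundary of a convex body\<close>

lemma chart_has_derivative:
  assumes "local_parametrization \<Sigma> U X" "u \<in> U"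
  shows "(X has_derivative frechet_derivative X (at u)) (at u)"
proof -
  have "Ck_on (Suc 0) U X" using assms by (auto simp: local_parametrization_def smooth_on_def)
  then have "X differentiable (at u)" using assms by simp
  then show ?thesis by (simp add: frechet_derivative_works)
qed

lemma chart_continuous:
  assumes "local_parametrization \<Sigma> U X"
  shows "continuous_on U X" "continuous_on U (\<lambda>u. frechet_derivative X (at u) h)"
proof -
  have "Ck_on 0 U X" "Ck_on (Suc 0) U X"
    using assms unfolding local_parametrization_def smooth_on_def by blast+
  then show "continuous_on U X" "continuous_on U (\<lambda>u. frechet_derivative X (at u) h)"
    by (simp_all del: split_paired_All)
qed

lemma chart_in_surface:
  assumes "local_parametrization \<Sigma> U X" "u \<in> U"
  shows "X u \<in> \<Sigma>"
  using assms by (auto simp: local_parametrization_def dest!: openin_imp_subset)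

definition chart_normal :: "(real \<times> real \<Rightarrow> heis) \<Rightarrow> real \<times> real \<Rightarrow> heis" where
  "chart_normal X u = cross (frechet_derivative X (at u) (1, 0)) (frechet_derivative X (at u) (0, 1))"

lemma chart_normal_nonzero:
  assumes "local_parametrization \<Sigma> U X" "u \<in> U"
  shows "chart_normal X u \<noteq> 0"
  unfolding chart_normal_def
  using assms chart_has_derivative[OF assms]
  by (intro cross_nonzero_if_inj has_derivative_linear) (auto simp: local_parametrization_def)

text \<open>The linear function \<open>a\<close> restricted to the surface is maximal at \<open>X u\<close>.\<close>

lemma chart_derivative_in_supporting_plane:
  assumes X: "local_parametrization \<Sigma> U X" "u \<in> U"
    and a: "\<And>x. x \<in> \<Sigma> \<Longrightarrow> a \<bullet> x \<le> a \<bullet> X u"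
  shows "frechet_derivative X (at u) h \<bullet> a = 0"
proof -
  have "((\<lambda>u. a \<bullet> X u) has_derivative (\<lambda>h. a \<bullet> frechet_derivative X (at u) h)) (at u)"
    by (intro derivative_intros chart_has_derivative[OF X])
  from differential_zero_maxmin[OF X(2) _ this]
  have "(\<lambda>h. a \<bullet> frechet_derivative X (at u) h) = (\<lambda>v. 0)"
    using X a chart_in_surface[OF X(1)] by (auto simp: local_parametrization_def)
  from fun_cong[OF this, of h] show ?thesis by (simp add: inner_commute)
qed

lemma tangent_vector_in_supporting_plane:
  assumes "z \<in> tangent_space \<Sigma> q" and a: "\<And>x. x \<in> \<Sigma> \<Longrightarrow> a \<bullet> x \<le> a \<bullet> q"
  shows "z \<bullet> a = 0"
proof -
  obtain c where c: "c 0 = q" "\<forall>\<^sub>F s in nhds 0. c s \<in> \<Sigma>" "(c has_vector_derivative z) (at 0)"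
    using assms(1) by (auto simp: tangent_space_def)
  obtain S :: "real set" where S: "open S" "0 \<in> S" "\<forall>s\<in>S. c s \<in> \<Sigma>"
    using c(2) unfolding eventually_nhds by blast
  have "((\<lambda>s. a \<bullet> c s) has_derivative (\<lambda>h. a \<bullet> (h *\<^sub>R z))) (at 0)"
    using c(3) unfolding has_vector_derivative_def by (intro derivative_intros)
  from differential_zero_maxmin[OF S(2,1) this]
  have "(\<lambda>h. a \<bullet> (h *\<^sub>R z)) = (\<lambda>v. 0)" using a c(1) S(3) by auto
  from fun_cong[OF this, of 1] show ?thesis by (simp add: inner_commute)
qed

text \<open>
  Tangent vectors are defined by arbitrary curves in the surface, and a supporting plane catches all of them
  at once. This replaces the usual argument that lifts a curve to the chart, for which one would need a
  differentiable inverse of \<open>X\<close>.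
\<close>

lemma tangent_space_chart:
  assumes X: "local_parametrization \<Sigma> U X" "u \<in> U"
    and a: "a \<noteq> 0" "\<And>x. x \<in> \<Sigma> \<Longrightarrow> a \<bullet> x \<le> a \<bullet> X u"
  shows "tangent_space \<Sigma> (X u) = {z. z \<bullet> chart_normal X u = 0}"
proof (intro equalityI subsetI CollectI)
  fix z assume "z \<in> tangent_space \<Sigma> (X u)"
  then have "z \<bullet> a = 0" using a(2) by (rule tangent_vector_in_supporting_plane)
  then show "z \<bullet> chart_normal X u = 0"
    unfolding chart_normal_def
    using chart_derivative_in_supporting_plane[OF X a(2)] a(1)
    by (intro coplanar_determinant_zero[of _ a]) auto
next
  fix z assume "z \<in> {z. z \<bullet> chart_normal X u = 0}"
  then obtain \<alpha> \<beta> where z: "z = \<alpha> *\<^sub>R frechet_derivative X (at u) (1, 0) + \<beta> *\<^sub>R frechet_derivative X (at u) (0, 1)"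
    using orthogonal_complement_cross chart_normal_nonzero[OF X] unfolding chart_normal_def by blast
  note D = chart_has_derivative[OF X]
  have lin: "linear (frechet_derivative X (at u))" using D by (rule has_derivative_linear)
  have z': "z = frechet_derivative X (at u) (\<alpha>, \<beta>)"
    unfolding z linear_scale[OF lin, symmetric] linear_add[OF lin, symmetric] by simp
  let ?g = "\<lambda>s::real. u + s *\<^sub>R (\<alpha>, \<beta>)"
  have "((\<lambda>s. X (?g s)) has_vector_derivative z) (at 0)"
  proof -
    have "(?g has_derivative (\<lambda>s. s *\<^sub>R (\<alpha>, \<beta>))) (at 0)"
      by (auto intro!: derivative_eq_intros)
    then have "((X \<circ> ?g) has_derivative (frechet_derivative X (at u) \<circ> (\<lambda>s. s *\<^sub>R (\<alpha>, \<beta>)))) (at 0)"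
      by (rule diff_chain_at) (use D in \<open>simp flip: zero_prod_def\<close>)
    then show ?thesis
      by (simp add: has_vector_derivative_def o_def linear_scale[OF lin] z' del: scaleR_Pair)
  qed
  moreover have "\<forall>\<^sub>F s in nhds 0. X (?g s) \<in> \<Sigma>"
  proof -
    have "open U" using X by (simp add: local_parametrization_def)
    moreover have "continuous_on UNIV ?g" by (intro continuous_intros)
    ultimately have "open (?g -` U)" by (rule open_vimage)
    then have "\<forall>\<^sub>F s in nhds 0. s \<in> ?g -` U" using X(2)
      by (intro eventually_nhds_in_open) (auto simp flip: zero_prod_def)
    then show ?thesis by eventually_elim (auto intro: chart_in_surface[OF X(1)])
  qed
  moreover have "X (?g 0) = X u" by (simp flip: zero_prod_def)
  ultimately show "z \<in> tangent_space \<Sigma> (X u)"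
    unfolding tangent_space_def mem_Collect_eq by (intro exI[of _ "\<lambda>s. X (?g s)"] conjI)
qed

lemma chart_p_area_density:
  assumes D: "open D" "convex D" "D \<noteq> {}"
    and X: "local_parametrization (frontier D) U X" "u \<in> U"
  shows "p_area_density (frontier D) (X u) (frechet_derivative X (at u) (1, 0))
      (frechet_derivative X (at u) (0, 1))
    = sqrt ((std_e1 (X u) \<bullet> chart_normal X u)\<^sup>2 + (std_e2 (X u) \<bullet> chart_normal X u)\<^sup>2)"
proof -
  have cl: "X u \<in> closure D" and "X u \<notin> D"
    using chart_in_surface[OF X] D(1) by (auto simp: frontier_def interior_open)
  then have "{X u} \<inter> D = {}" by simp
  from supporting_hyperplane_containing[OF D(2,3) convex_singleton this singletonI cl]
  obtain a where "a \<noteq> 0" "\<forall>x\<in>closure D. a \<bullet> x \<le> a \<bullet> X u" by blast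
  then have "tangent_space (frontier D) (X u) = {z. z \<bullet> chart_normal X u = 0}"
    by (intro tangent_space_chart[OF X]) (auto simp: frontier_def)
  then show ?thesis
    unfolding chart_normal_def
    by (rule p_area_density_eq) (use chart_normal_nonzero[OF X] in \<open>simp add: chart_normal_def\<close>)
qed

text \<open>
  If the line through a boundary point is disjoint from \<open>D\<close>, a plane separates it from \<open>D\<close>. This plane supports \<open>D\<close>
  at the point, hence contains both the tangent vectors of the chart and the direction of the line.
\<close>

lemma hdir_tangent_off_line_ends:
  assumes D: "open D" "convex D" "D \<noteq> {}"
    and X: "local_parametrization (frontier D) U X" "u \<in> U"
    and off: "X u \<notin> line_ends D \<theta> 1" "X u \<notin> line_ends D \<theta> (- 1)"
  shows "hdir \<theta> (X u) \<bullet> chart_normal X u = 0"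
proof -
  define q where "q = X u"
  define h where "h = hdir \<theta> q"
  have fr: "q \<in> frontier D" using chart_in_surface[OF X] by (simp add: q_def)
  then have q: "q \<in> closure D" "q \<notin> D"
    using D(1) by (auto simp: frontier_def interior_open)
  have line: "q + s *\<^sub>R h \<notin> D" for s
  proof
    assume s: "q + s *\<^sub>R h \<in> D"
    consider "s = 0" | "s > 0" | "s < 0" by linarith
    then show False
    proof cases
      case 1 then show False using s q by simp
    next
      case 2 then show False using s off fr by (auto simp: line_ends_def q_def h_def)
    next
      case 3
      then have "- s > 0 \<and> q + (- 1 * - s) *\<^sub>R h \<in> D" using s by simp
      then show False using off fr unfolding line_ends_def q_def h_def by blast
    qed
  qed
  have conv: "convex (range (\<lambda>s. q + s *\<^sub>R h))"
  proof -
    have "range (\<lambda>s. q + s *\<^sub>R h) = (+) q ` span {h}" by (auto simp: span_singleton)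
    then show ?thesis by (simp add: convex_translation subspace_imp_convex)
  qed
  have disj: "range (\<lambda>s. q + s *\<^sub>R h) \<inter> D = {}" using line by blast
  have "q = q + 0 *\<^sub>R h" by simp
  then have on: "q \<in> range (\<lambda>s. q + s *\<^sub>R h)" by blast
  obtain a where a: "a \<noteq> 0" "\<And>x. x \<in> closure D \<Longrightarrow> a \<bullet> x \<le> a \<bullet> q"
      "\<And>x. x \<in> range (\<lambda>s. q + s *\<^sub>R h) \<Longrightarrow> a \<bullet> q \<le> a \<bullet> x"
    using supporting_hyperplane_containing[OF D(2,3) conv disj on q(1)] by blast
  \<comment> \<open>A linear function bounded below on a line is constant on it; two points suffice to see this.\<close>
  have "a \<bullet> q \<le> a \<bullet> (q + 1 *\<^sub>R h)" "a \<bullet> q \<le> a \<bullet> (q + (- 1) *\<^sub>R h)"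
    by (intro a(3) rangeI)+
  then have "h \<bullet> a = 0" by (simp add: inner_add_right inner_diff_right inner_commute)
  then show ?thesis
    unfolding chart_normal_def h_def q_def
    using chart_derivative_in_supporting_plane[OF X, of a] a(1,2)
    by (intro coplanar_determinant_zero[of _ a]) (auto simp: q_def frontier_def)
qed

lemma continuous_on_chart_normal:
  assumes "local_parametrization \<Sigma> U X"
  shows "continuous_on U (chart_normal X)"
  unfolding chart_normal_def cross_def case_prod_unfold
  by (intro continuous_intros chart_continuous(2)[OF assms])

text \<open>
  The condition to enter \<open>D\<close> after moving by a fixed \<open>\<tau>\<close> is open, and line ends are described by the union over
  all \<open>\<tau> > 0\<close>.
\<close>

lemma chart_line_ends_borel:
  assumes "open D" and X: "local_parametrization (frontier D) U X"
    and A: "A \<in> sets borel" "A \<subseteq> U"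
  shows "{u \<in> A. X u \<in> line_ends D \<theta> \<epsilon>} \<in> sets borel"
proof -
  have U: "open U" using X by (simp add: local_parametrization_def)
  let ?g = "\<lambda>\<tau> u. X u + (\<epsilon> * \<tau>) *\<^sub>R hdir \<theta> (X u)"
  have "open (U \<inter> ?g \<tau> -` D)" for \<tau>
    by (intro continuous_open_preimage U assms continuous_intros chart_continuous(1)[OF X])
  then have "open (\<Union>\<tau>\<in>{0<..}. U \<inter> ?g \<tau> -` D)" by blast
  moreover have "{u \<in> A. X u \<in> line_ends D \<theta> \<epsilon>} = A \<inter> (\<Union>\<tau>\<in>{0<..}. U \<inter> ?g \<tau> -` D)"
    using A chart_in_surface[OF X] by (auto simp: line_ends_def)
  ultimately show ?thesis using A by auto
qed

lemma chart_jacobian_measurable: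
  assumes X: "local_parametrization \<Sigma> U X" and A: "A \<in> sets borel" "A \<subseteq> U"
  shows "set_borel_measurable borel A (\<lambda>u. std_e1 (X u) \<bullet> chart_normal X u)"
    and "set_borel_measurable borel A (\<lambda>u. std_e2 (X u) \<bullet> chart_normal X u)"
    and "set_borel_measurable borel A (\<lambda>u. hdir \<theta> (X u) \<bullet> chart_normal X u)"
  unfolding set_borel_measurable_def
  by (intro borel_measurable_continuous_on_indicator A continuous_on_subset[OF _ A(2)]
      continuous_intros continuous_on_chart_normal[OF X] chart_continuous(1)[OF X])+

lemma set_nn_integral_measurable:
  fixes f :: "'a::topological_space \<Rightarrow> real"
  assumes "set_borel_measurable borel A f"
  shows "(\<lambda>u. ennreal \<bar>f u\<bar> * indicator A u) \<in> borel_measurable borel"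
proof -
  have "(\<lambda>u. ennreal \<bar>indicator A u *\<^sub>R f u\<bar>) \<in> borel_measurable borel"
    using assms unfolding set_borel_measurable_def by measurable
  also have "(\<lambda>u. ennreal \<bar>indicator A u *\<^sub>R f u\<bar>) = (\<lambda>u. ennreal \<bar>f u\<bar> * indicator A u)"
    by (auto simp: fun_eq_iff indicator_def)
  finally show ?thesis .
qed

text \<open>
  By Lindelof's theorem countably many charts cover the surface; the pieces are obtained by removing from
  each chart the images of the previous ones, which are relatively open.
\<close>

lemma chart_decomposition_exists:
  assumes "smooth_surface \<Sigma>" "\<Sigma> \<noteq> {}"
  shows "\<exists>U X A. chart_decomposition \<Sigma> U X A"
proof -
  define \<F> where "\<F> = {X ` U | U X. local_parametrization \<Sigma> U X}"
  have cover: "\<Union>\<F> = \<Sigma>"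
  proof
    show "\<Union>\<F> \<subseteq> \<Sigma>"
    proof
      fix q assume "q \<in> \<Union>\<F>"
      then obtain U X u where "local_parametrization \<Sigma> U X" "u \<in> U" "q = X u"
        unfolding \<F>_def by blast
      then show "q \<in> \<Sigma>" using chart_in_surface by simp
    qed
    show "\<Sigma> \<subseteq> \<Union>\<F>"
    proof
      fix q assume "q \<in> \<Sigma>"
      then obtain U X where "local_parametrization \<Sigma> U X" "q \<in> X ` U"
        using assms(1) unfolding smooth_surface_def by blast
      moreover from this have "X ` U \<in> \<F>" unfolding \<F>_def by blast
      ultimately show "q \<in> \<Union>\<F>" by (meson UnionI)
    qed
  qed
  have "\<And>S. S \<in> \<F> \<Longrightarrow> openin (top_of_set \<Sigma>) S"
    by (auto simp: \<F>_def local_parametrization_def)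
  then obtain \<G> where \<G>: "\<G> \<subseteq> \<F>" "countable \<G>" "\<Union>\<G> = \<Sigma>"
    using Lindelof_openin[of \<F> \<Sigma>] cover by metis
  have "\<G> \<noteq> {}" using \<G>(3) assms(2) by auto
  have "\<forall>n. \<exists>U X. local_parametrization \<Sigma> U X \<and> from_nat_into \<G> n = X ` U"
  proof
    fix n
    have "from_nat_into \<G> n \<in> \<F>"
      using from_nat_into[OF \<open>\<G> \<noteq> {}\<close>] \<G>(1) by (rule subsetD[rotated])
    then show "\<exists>U X. local_parametrization \<Sigma> U X \<and> from_nat_into \<G> n = X ` U"
      unfolding \<F>_def by blast
  qed
  then obtain U X where X: "\<And>n. local_parametrization \<Sigma> (U n) (X n)"
    and im: "\<And>n. from_nat_into \<G> n = X n ` U n" by metis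
  have all: "(\<Union>n. X n ` U n) = \<Sigma>"
    using \<G>(3) range_from_nat_into[OF \<open>\<G> \<noteq> {}\<close> \<G>(2)] by (simp flip: im)
  define A where "A n = {u \<in> U n. X n u \<notin> (\<Union>m<n. X m ` U m)}" for n
  have restrict: "f ` {u \<in> S. f u \<notin> W} = f ` S - W" for f :: "real \<times> real \<Rightarrow> heis" and S W
    by blast
  have image: "X n ` A n = X n ` U n - (\<Union>m<n. X m ` U m)" for n
    unfolding A_def by (rule restrict)
  have "A n \<in> sets borel" for n
  proof -
    have "openin (top_of_set \<Sigma>) (\<Union>m<n. X m ` U m)"
      using X by (intro openin_Union) (auto simp: local_parametrization_def)
    then obtain V where V: "open V" "(\<Union>m<n. X m ` U m) = \<Sigma> \<inter> V" by (auto simp: openin_open)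
    have U: "open (U n)" using X[of n] by (simp add: local_parametrization_def)
    have "open (U n \<inter> X n -` V)"
      by (intro continuous_open_preimage U V chart_continuous(1)[OF X])
    moreover have "A n = U n - (U n \<inter> X n -` V)"
      using chart_in_surface[OF X] by (auto simp: A_def V(2))
    ultimately show ?thesis using U by auto
  qed
  moreover have "disjoint_family (\<lambda>n. X n ` A n)"
    unfolding image using disjoint_family_disjointed[of "\<lambda>n. X n ` U n"]
    by (simp add: disjointed_def[abs_def] lessThan_atLeast0)
  moreover have "(\<Union>n. X n ` A n) = \<Sigma>"
    unfolding image using UN_disjointed_eq[of "\<lambda>n. X n ` U n"] all
    by (simp add: disjointed_def[abs_def] lessThan_atLeast0)
  ultimately have "chart_decomposition \<Sigma> U X A"
    using X by (auto simp: chart_decomposition_def A_def)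
  then show ?thesis by blast
qed

section \<open>The measure of the set of lines meeting a body\<close>

lemma continuous_on_hline: "continuous_on S (\<lambda>(G, s). hline G s)"
  unfolding hline_def case_prod_unfold by (intro continuous_intros)

lemma hline_measurable [measurable]:
  "(\<lambda>(G, s). hline G s) \<in> borel_measurable (borel \<Otimes>\<^sub>M borel)"
  unfolding borel_prod by (intro borel_measurable_continuous_onI continuous_on_hline)

text \<open>The triples that parametrize oriented horizontal lines, each line once.\<close>

definition strip :: "(real \<times> real \<times> real) set" where
  "strip = UNIV \<times> {0..<2 * pi} \<times> UNIV"

lemma strip_borel [measurable]: "strip \<in> sets borel"
proof -
  have "(\<lambda>G :: real \<times> real \<times> real. fst (snd G)) \<in> borel_measurable borel"
    by (intro borel_measurable_continuous_onI continuous_intros)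
  from measurable_sets[OF this, of "{0..<2 * pi}"]
  have "(\<lambda>G. fst (snd G)) -` {0..<2 * pi} \<in> sets (borel :: (real \<times> real \<times> real) measure)" by simp
  also have "(\<lambda>G. fst (snd G)) -` {0..<2 * pi} = strip" by (auto simp: strip_def)
  finally show ?thesis .
qed

lemma open_lines_through:
  assumes "open D"
  shows "open {G. range (hline G) \<inter> D \<noteq> {}}"
proof -
  have "{G. range (hline G) \<inter> D \<noteq> {}} = (\<Union>s. (\<lambda>G. hline G s) -` D)" by auto
  moreover have "open ((\<lambda>G. hline G s) -` D)" for s
    by (intro open_vimage assms) (auto simp: hline_def case_prod_unfold intro!: continuous_intros)
  ultimately show ?thesis by auto
qed

lemma lines_meeting_strip: "lines_meeting D = {G. range (hline G) \<inter> D \<noteq> {}} \<inter> strip"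
  by (auto simp: lines_meeting_def strip_def)

lemma lines_meeting_borel: "open D \<Longrightarrow> lines_meeting D \<in> sets borel"
  unfolding lines_meeting_strip using open_lines_through strip_borel by (intro sets.Int) auto

lemma lines_meeting_iff:
  "(p, \<theta>, t) \<in> lines_meeting D \<longleftrightarrow> \<theta> \<in> {0..<2 * pi} \<and> vec_of (p, t) \<in> hproj \<theta> ` D"
proof -
  have "range (hline (p, \<theta>, t)) \<inter> D \<noteq> {} \<longleftrightarrow> vec_of (p, t) \<in> hproj \<theta> ` D"
  proof
    assume "range (hline (p, \<theta>, t)) \<inter> D \<noteq> {}"
    then show "vec_of (p, t) \<in> hproj \<theta> ` D"
      using hproj_hline by (force simp: image_iff)
  next
    assume "vec_of (p, t) \<in> hproj \<theta> ` D"
    then obtain q where "q \<in> D" "hproj \<theta> q = vec_of (p, t)" by auto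
    then show "range (hline (p, \<theta>, t)) \<inter> D \<noteq> {}" using on_hline by blast
  qed
  then show ?thesis by (auto simp: lines_meeting_def)
qed

lemma nn_integral_lines:
  assumes [measurable]: "f \<in> borel_measurable borel"
  shows "(\<integral>\<^sup>+G. f G \<partial>(lborel :: (real \<times> real \<times> real) measure))
     = (\<integral>\<^sup>+\<theta>. \<integral>\<^sup>+p. \<integral>\<^sup>+t. f (p, \<theta>, t) \<partial>lborel \<partial>lborel \<partial>lborel)"
proof -
  have "(\<integral>\<^sup>+G. f G \<partial>(lborel :: (real \<times> real \<times> real) measure))
     = (\<integral>\<^sup>+p. \<integral>\<^sup>+\<theta>. \<integral>\<^sup>+t. f (p, \<theta>, t) \<partial>lborel \<partial>lborel \<partial>lborel)"
    by (subst nn_integral_pair, simp, subst nn_integral_pair, simp_all)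
  also have "\<dots> = (\<integral>\<^sup>+\<theta>. \<integral>\<^sup>+p. \<integral>\<^sup>+t. f (p, \<theta>, t) \<partial>lborel \<partial>lborel \<partial>lborel)"
    by (rule lborel_pair.Fubini'[symmetric]) measurable
  finally show ?thesis .
qed

lemma lines_meeting_slice:
  assumes "open D"
  shows "(\<integral>\<^sup>+p. \<integral>\<^sup>+t. indicator (lines_meeting D) (p, \<theta>, t) \<partial>lborel \<partial>lborel)
    = emeasure lborel (hproj \<theta> ` D) * indicator {0..<2 * pi} \<theta>"
proof -
  have "indicator (lines_meeting D) (p, \<theta>, t)
      = (indicator (hproj \<theta> ` D) (vec_of (p, t)) * indicator {0..<2 * pi} \<theta> :: ennreal)" for p t
    by (auto simp add: indicator_def lines_meeting_iff)
  moreover have "hproj \<theta> ` D \<in> sets borel" using open_hproj_image[OF assms] by simp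
  ultimately show ?thesis
    by (cases "\<theta> \<in> {0..<2 * pi}") (simp_all add: emeasure_plane)
qed

text \<open>
  The slice areas of a Borel set in space are measurable by Tonelli, although \<open>hproj \<theta> ` D\<close> is given as an
  image.
\<close>

lemma lines_slice_measurable:
  assumes "open D"
  shows "(\<lambda>\<theta>. emeasure lborel (hproj \<theta> ` D) * indicator {0..<2 * pi} \<theta>) \<in> borel_measurable borel"
proof -
  have [measurable]: "lines_meeting D \<in> sets borel" by (rule lines_meeting_borel[OF assms])
  show ?thesis unfolding lines_meeting_slice[OF assms, symmetric] by measurable
qed

lemma emeasure_lines_meeting:
  assumes "open D"
  shows "emeasure lborel (lines_meeting D)
    = (\<integral>\<^sup>+\<theta>\<in>{0..<2 * pi}. emeasure lborel (hproj \<theta> ` D) \<partial>lborel)"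
proof -
  have [measurable]: "lines_meeting D \<in> sets borel" by (rule lines_meeting_borel[OF assms])
  have "emeasure lborel (lines_meeting D) = (\<integral>\<^sup>+G. indicator (lines_meeting D) G \<partial>lborel)" by simp
  also have "\<dots> = (\<integral>\<^sup>+\<theta>. \<integral>\<^sup>+p. \<integral>\<^sup>+t. indicator (lines_meeting D) (p, \<theta>, t) \<partial>lborel \<partial>lborel \<partial>lborel)"
    by (rule nn_integral_lines) simp
  finally show ?thesis by (simp add: lines_meeting_slice[OF assms])
qed

text \<open>
  A line point \<open>(x, y, t + s * p)\<close> determines \<open>s\<close> and \<open>p\<close> as the components of \<open>(x, y)\<close> in an orthonormal
  frame.
\<close>

lemma hline_parameters_bounded:
  assumes "hline (p, \<theta>, t) s \<in> D" "\<And>q. q \<in> D \<Longrightarrow> norm q \<le> B"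
  shows "\<bar>s\<bar> \<le> 2 * B" "\<bar>p\<bar> \<le> 2 * B" "\<bar>t\<bar> \<le> B + 4 * B\<^sup>2"
proof -
  define x y where "x = p * cos \<theta> + s * sin \<theta>" "y = p * sin \<theta> - s * cos \<theta>"
  have "norm (x, y, t + s * p) \<le> B"
    using assms by (simp add: hline_def x_y_def)
  then have b: "\<bar>x\<bar> \<le> B" "\<bar>y\<bar> \<le> B" "\<bar>t + s * p\<bar> \<le> B"
    using norm_fst_le[of x "(y, t + s * p)"] norm_snd_le[of "(y, t + s * p)" x]
      norm_fst_le[of y "t + s * p"] norm_snd_le[of "t + s * p" y] by auto
  have le: "\<bar>u * c\<bar> \<le> B" if "\<bar>u\<bar> \<le> B" "\<bar>c\<bar> \<le> 1" for u c :: real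
    using mult_mono[of "\<bar>u\<bar>" B "\<bar>c\<bar>" 1] that by (simp add: abs_mult)
  have "s = x * sin \<theta> - y * cos \<theta>" "p = x * cos \<theta> + y * sin \<theta>"
    using sin_cos_products[of \<theta>] unfolding x_y_def by algebra+
  then show s: "\<bar>s\<bar> \<le> 2 * B" and p: "\<bar>p\<bar> \<le> 2 * B"
    using le[OF b(1), of "sin \<theta>"] le[OF b(2), of "cos \<theta>"]
      le[OF b(1), of "cos \<theta>"] le[OF b(2), of "sin \<theta>"] by auto
  have "\<bar>s * p\<bar> \<le> 2 * B * (2 * B)"
    unfolding abs_mult using s p by (intro mult_mono) auto
  then show "\<bar>t\<bar> \<le> B + 4 * B\<^sup>2" using b(3) by (simp add: power2_eq_square)
qed

lemma bounded_lines_meeting: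
  assumes "bounded D"
  shows "bounded (lines_meeting D)"
proof -
  obtain B where B: "\<And>q. q \<in> D \<Longrightarrow> norm q \<le> B" using assms by (auto simp: bounded_iff)
  have "lines_meeting D \<subseteq> {- 2 * B..2 * B} \<times> {0..2 * pi} \<times> {- (B + 4 * B\<^sup>2)..B + 4 * B\<^sup>2}"
  proof
    fix G assume G: "G \<in> lines_meeting D"
    obtain p \<theta> t where pt: "G = (p, \<theta>, t)" by (cases G)
    obtain s where "hline (p, \<theta>, t) s \<in> D" using G by (auto simp: lines_meeting_def pt)
    from hline_parameters_bounded[OF this B]
    show "G \<in> {- 2 * B..2 * B} \<times> {0..2 * pi} \<times> {- (B + 4 * B\<^sup>2)..B + 4 * B\<^sup>2}"
      using G by (auto simp: pt lines_meeting_def)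
  qed
  then show ?thesis by (rule bounded_subset[rotated]) (intro bounded_Times bounded_closed_interval)
qed

text \<open>
  The strip of parameters is not open at \<open>\<theta> = 0\<close>, but its interior already contains a line through any given point
  of \<open>D\<close>, for instance the one with \<open>\<theta> = pi\<close>.
\<close>

lemma emeasure_lines_meeting_pos:
  assumes "open D" "D \<noteq> {}"
  shows "emeasure lborel (lines_meeting D) > 0"
proof -
  let ?W = "{G. range (hline G) \<inter> D \<noteq> {}} \<inter> UNIV \<times> {0<..<2 * pi} \<times> UNIV"
  have W: "open ?W"
    by (intro open_Int open_Times open_lines_through assms open_UNIV open_greaterThanLessThan)
  obtain q where q: "q \<in> D" using assms by auto
  obtain p t where "hproj pi q = vec_of (p, t)" by (metis pair_of_vec_of surj_pair vec_of_pair_of)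
  from on_hline[OF this] q have "(p, pi, t) \<in> ?W" by auto
  then have "?W \<noteq> {}" by blast
  then have "\<not> negligible ?W" using W by (rule open_not_negligible[rotated])
  then have "emeasure lborel ?W \<noteq> 0"
    using W by (auto simp: negligible_iff_null_sets null_sets_def)
  then have "0 < emeasure lborel ?W" by (simp add: zero_less_iff_neq_zero)
  also have "\<dots> \<le> emeasure lborel (lines_meeting D)"
    using lines_meeting_borel[OF assms(1)]
    by (intro emeasure_mono) (auto simp: lines_meeting_strip strip_def)
  finally show ?thesis .
qed

section \<open>Crofton's formula\<close>

text \<open>
  The area formula for \<open>hproj \<theta> \<circ> X\<close>, which is injective on the entry points, and likewise on the exit
  points.
\<close>

lemma area_of_projected_line_ends:
  fixes \<theta> \<epsilon> :: real
  assumes D: "open D" "convex D" "bounded D" and X: "local_parametrization (frontier D) U X"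
    and A: "A \<in> sets borel" "A \<subseteq> U" and "\<epsilon> \<noteq> 0"
  defines "S \<equiv> {u \<in> A. X u \<in> line_ends D \<theta> \<epsilon>}"
  shows "(\<lambda>u. hproj \<theta> (X u)) ` S \<in> sets lebesgue"
    and "(\<integral>\<^sup>+u\<in>S. ennreal \<bar>hdir \<theta> (X u) \<bullet> chart_normal X u\<bar> \<partial>lborel)
      = emeasure lebesgue ((\<lambda>u. hproj \<theta> (X u)) ` S)"
proof -
  define F where "F u = hproj \<theta> (X u)" for u
  define F' where "F' u h = hproj_deriv \<theta> (X u) (frechet_derivative X (at u) h)" for u h
  have S: "S \<in> sets borel" "S \<subseteq> U"
    unfolding S_def using chart_line_ends_borel[OF D(1) X A] A by auto
  have der: "(F has_derivative F' u) (at u)" if "u \<in> S" for u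
    using diff_chain_at[OF chart_has_derivative[OF X, of u] has_derivative_hproj] that S(2)
    unfolding F_def F'_def o_def by auto
  have "inj_on X U"
    using X unfolding local_parametrization_def homeomorphism_def by (metis inj_on_inverseI)
  moreover have "inj_on (hproj \<theta>) (X ` S)"
    by (rule inj_on_subset[OF inj_on_hproj_line_ends[OF D(2,1) \<open>\<epsilon> \<noteq> 0\<close>]]) (auto simp: S_def)
  ultimately have "inj_on (hproj \<theta> \<circ> X) S"
    using comp_inj_on[of X S "hproj \<theta>"] S(2) by (auto simp: inj_on_subset)
  also have "hproj \<theta> \<circ> X = F" by (simp add: fun_eq_iff F_def)
  finally have inj: "inj_on F S" .
  have "F ` S \<subseteq> hproj \<theta> ` closure D"
    using chart_in_surface[OF X] S(2) by (auto simp: F_def frontier_def)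
  moreover have "compact (hproj \<theta> ` closure D)"
    using D(3) by (intro compact_continuous_image continuous_on_hproj) (simp add: compact_closure)
  ultimately have bdd: "bounded (F ` S)" by (meson bounded_subset compact_imp_bounded)
  have jac: "det2 (F' u (1, 0)) (F' u (0, 1)) = hdir \<theta> (X u) \<bullet> chart_normal X u" for u
    by (simp add: F'_def det2_hproj_deriv chart_normal_def)
  have meas: "set_borel_measurable borel S (\<lambda>u. det2 (F' u (1, 0)) (F' u (0, 1)))"
    unfolding jac by (rule chart_jacobian_measurable[OF X S])
  from area_of_injective_image[OF S(1) der inj bdd meas]
  show "(\<lambda>u. hproj \<theta> (X u)) ` S \<in> sets lebesgue"
    and "(\<integral>\<^sup>+u\<in>S. ennreal \<bar>hdir \<theta> (X u) \<bullet> chart_normal X u\<bar> \<partial>lborel)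
      = emeasure lebesgue ((\<lambda>u. hproj \<theta> (X u)) ` S)"
    unfolding jac unfolding F_def by auto
qed

text \<open>
  The surface consists of the entry points, the exit points and the points where the integrand vanishes.
  On each of the first two sets \<open>hproj \<theta>\<close> is a bijection onto \<open>hproj \<theta> ` D\<close>, so each contributes the area
  of this set; the disjoint pieces of the decomposition have disjoint projections and their areas add up.
\<close>

lemma crofton_in_one_direction:
  assumes D: "open D" "convex D" "bounded D" "D \<noteq> {}"
    and dec: "chart_decomposition (frontier D) U X A"
  shows "(\<Sum>n. \<integral>\<^sup>+u\<in>A n. ennreal \<bar>hdir \<theta> (X n u) \<bullet> chart_normal (X n) u\<bar> \<partial>lborel)
    = 2 * emeasure lborel (hproj \<theta> ` D)"
proof -
  have X: "local_parametrization (frontier D) (U n) (X n)"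
    and A: "A n \<in> sets borel" "A n \<subseteq> U n" for n
    using dec by (auto simp: chart_decomposition_def)
  have disj: "disjoint_family (\<lambda>n. X n ` A n)" and cover: "(\<Union>n. X n ` A n) = frontier D"
    using dec by (auto simp: chart_decomposition_def)
  define f where "f n u = ennreal \<bar>hdir \<theta> (X n u) \<bullet> chart_normal (X n) u\<bar>" for n u
  define S where "S \<epsilon> n = {u \<in> A n. X n u \<in> line_ends D \<theta> \<epsilon>}" for \<epsilon> n
  define P where "P \<epsilon> n = (\<lambda>u. hproj \<theta> (X n u)) ` S \<epsilon> n" for \<epsilon> n
  have total: "(\<Sum>n. \<integral>\<^sup>+u\<in>S \<epsilon> n. f n u \<partial>lborel) = emeasure lborel (hproj \<theta> ` D)" if "\<epsilon> \<noteq> 0" for \<epsilon>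
  proof -
    have P: "P \<epsilon> n \<in> sets lebesgue" "(\<integral>\<^sup>+u\<in>S \<epsilon> n. f n u \<partial>lborel) = emeasure lebesgue (P \<epsilon> n)" for n
      unfolding P_def S_def f_def using area_of_projected_line_ends[OF D(1-3) X A that] by auto
    have PX: "P \<epsilon> n = hproj \<theta> ` (X n ` A n \<inter> line_ends D \<theta> \<epsilon>)" for n
      by (auto simp: P_def S_def)
    have "disjoint_family (P \<epsilon>)"
      unfolding disjoint_family_on_def
    proof (intro ballI impI)
      fix m n :: nat assume "m \<noteq> n"
      then have "X m ` A m \<inter> X n ` A n = {}" using disj by (auto simp: disjoint_family_on_def)
      moreover have "P \<epsilon> m \<inter> P \<epsilon> n = hproj \<theta> `
         ((X m ` A m \<inter> line_ends D \<theta> \<epsilon>) \<inter> (X n ` A n \<inter> line_ends D \<theta> \<epsilon>))"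
        unfolding PX
        by (rule inj_on_image_Int[symmetric, OF inj_on_hproj_line_ends[OF D(2,1) that]]) auto
      ultimately show "P \<epsilon> m \<inter> P \<epsilon> n = {}" by blast
    qed
    then have "(\<Sum>n. emeasure lebesgue (P \<epsilon> n)) = emeasure lebesgue (\<Union>n. P \<epsilon> n)"
      using P(1) by (intro suminf_emeasure) auto
    also have "(\<Union>n. P \<epsilon> n) = hproj \<theta> ` (frontier D \<inter> line_ends D \<theta> \<epsilon>)"
      unfolding PX cover[symmetric] by blast
    also have "frontier D \<inter> line_ends D \<theta> \<epsilon> = line_ends D \<theta> \<epsilon>" by (auto simp: line_ends_def)
    also have "hproj \<theta> ` line_ends D \<theta> \<epsilon> = hproj \<theta> ` D"
      by (rule hproj_line_ends[OF D(1,3) that])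
    also have "emeasure lebesgue (hproj \<theta> ` D) = emeasure lborel (hproj \<theta> ` D)"
      using open_hproj_image[OF D(1)] by (simp add: emeasure_completion)
    finally show ?thesis by (simp add: P(2))
  qed
  have split: "(\<integral>\<^sup>+u\<in>A n. f n u \<partial>lborel)
      = (\<integral>\<^sup>+u\<in>S 1 n. f n u \<partial>lborel) + (\<integral>\<^sup>+u\<in>S (- 1) n. f n u \<partial>lborel)" for n
  proof -
    have m: "(\<lambda>u. f n u * indicator (S \<epsilon> n) u) \<in> borel_measurable borel" for \<epsilon>
    proof -
      have "S \<epsilon> n \<in> sets borel"
        unfolding S_def by (rule chart_line_ends_borel[OF D(1) X A])
      moreover have "S \<epsilon> n \<subseteq> U n" using A(2)[of n] by (auto simp: S_def)
      ultimately show ?thesis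
        unfolding f_def by (intro set_nn_integral_measurable chart_jacobian_measurable[OF X])
    qed
    have "f n u * indicator (A n) u = f n u * indicator (S 1 n) u + f n u * indicator (S (- 1) n) u" for u
    proof (cases "u \<in> A n \<and> u \<notin> S 1 n \<and> u \<notin> S (- 1) n")
      case True
      then have "hdir \<theta> (X n u) \<bullet> chart_normal (X n) u = 0"
        using A(2) by (intro hdir_tangent_off_line_ends[OF D(1,2,4) X]) (auto simp: S_def)
      then show ?thesis by (simp add: f_def)
    next
      case False
      then show ?thesis
        using line_ends_disjoint[OF D(2,1), of \<theta>] by (auto simp: S_def indicator_def)
    qed
    then show ?thesis using m by (simp add: nn_integral_add)
  qed
  have "(\<Sum>n. \<integral>\<^sup>+u\<in>A n. f n u \<partial>lborel)
    = (\<Sum>n. \<integral>\<^sup>+u\<in>S 1 n. f n u \<partial>lborel) + (\<Sum>n. \<integral>\<^sup>+u\<in>S (- 1) n. f n u \<partial>lborel)"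
    unfolding split by (rule suminf_add[symmetric]) (auto intro: summableI)
  also have "\<dots> = 2 * emeasure lborel (hproj \<theta> ` D)"
    using total[of 1] total[of "- 1"] by (simp add: mult_2)
  finally show ?thesis unfolding f_def .
qed

text \<open>
  Any value \<open>I\<close> of the p-area obtained from some decomposition into charts satisfies this equation, whose
  right-hand side depends on \<open>D\<close> only. The proof exchanges the integration over the surface with the one over the
  directions: in one order, \<open>nn_integral_abs_sinusoid\<close> turns the projected area elements into four times the
  p-area density; in the other, \<open>crofton_in_one_direction\<close> applies.
\<close>

lemma crofton_formula:
  assumes D: "open D" "convex D" "bounded D" "D \<noteq> {}"
    and I: "has_density_integral (p_area_density (frontier D)) I (frontier D)"
  shows "4 * I = 2 * (\<integral>\<^sup>+\<theta>\<in>{0..<2 * pi}. emeasure lborel (hproj \<theta> ` D) \<partial>lborel)"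
proof -
  obtain U X A where dec: "chart_decomposition (frontier D) U X A"
    and I: "I = (\<Sum>n. \<integral>\<^sup>+u\<in>A n. ennreal (p_area_density (frontier D) (X n u)
                   (frechet_derivative (X n) (at u) (1, 0))
                   (frechet_derivative (X n) (at u) (0, 1))) \<partial>lborel)"
    using I unfolding has_density_integral_def by blast
  have X: "local_parametrization (frontier D) (U n) (X n)"
    and A: "A n \<in> sets borel" "A n \<subseteq> U n" for n
    using dec by (auto simp: chart_decomposition_def)
  define a where "a n u = std_e1 (X n u) \<bullet> chart_normal (X n) u" for n u
  define b where "b n u = std_e2 (X n u) \<bullet> chart_normal (X n) u" for n u
  have [measurable]: "(\<lambda>u. indicator (A n) u *\<^sub>R a n u) \<in> borel_measurable borel"
    "(\<lambda>u. indicator (A n) u *\<^sub>R b n u) \<in> borel_measurable borel" for n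
    using chart_jacobian_measurable[OF X A, of n] unfolding set_borel_measurable_def a_def b_def by auto
  define f where "f n u \<theta> = ennreal \<bar>a n u * sin \<theta> - b n u * cos \<theta>\<bar> * indicator (A n) u
      * indicator {0..<2 * pi} \<theta>" for n u \<theta>
  \<comment> \<open>Cutting off \<open>a\<close> and \<open>b\<close> outside \<open>A n\<close> makes them measurable on the whole plane.\<close>
  have f: "f n u \<theta> = ennreal \<bar>(indicator (A n) u *\<^sub>R a n u) * sin \<theta> - (indicator (A n) u *\<^sub>R b n u) * cos \<theta>\<bar>
      * indicator {0..<2 * pi} \<theta>" for n u \<theta>
    by (simp add: f_def indicator_def)
  have fm: "(\<lambda>(\<theta>, u). f n u \<theta>) \<in> borel_measurable (lborel \<Otimes>\<^sub>M lborel)" for n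
    unfolding f by measurable
  have "4 * I = (\<Sum>n. 4 * (\<integral>\<^sup>+u\<in>A n. ennreal (sqrt ((a n u)\<^sup>2 + (b n u)\<^sup>2)) \<partial>lborel))"
    unfolding I ennreal_suminf_cmult
  proof (intro arg_cong[where f="\<lambda>x. 4 * x"] suminf_cong nn_integral_cong)
    fix n u
    show "ennreal (p_area_density (frontier D) (X n u) (frechet_derivative (X n) (at u) (1, 0))
          (frechet_derivative (X n) (at u) (0, 1))) * indicator (A n) u
        = ennreal (sqrt ((a n u)\<^sup>2 + (b n u)\<^sup>2)) * indicator (A n) u"
    proof (cases "u \<in> A n")
      case True
      with A(2)[of n] have "u \<in> U n" by blast
      from chart_p_area_density[OF D(1,2,4) X this] show ?thesis by (simp add: a_def b_def)
    qed simp
  qed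
  also have "\<dots> = (\<Sum>n. \<integral>\<^sup>+u. \<integral>\<^sup>+\<theta>. f n u \<theta> \<partial>lborel \<partial>lborel)"
  proof (intro suminf_cong)
    fix n
    have "4 * (\<integral>\<^sup>+u\<in>A n. ennreal (sqrt ((a n u)\<^sup>2 + (b n u)\<^sup>2)) \<partial>lborel)
      = (\<integral>\<^sup>+u. 4 * (ennreal (sqrt ((indicator (A n) u *\<^sub>R a n u)\<^sup>2 + (indicator (A n) u *\<^sub>R b n u)\<^sup>2))) \<partial>lborel)"
      by (subst nn_integral_cmult, measurable)
         (auto intro!: arg_cong[where f="\<lambda>x. 4 * x"] nn_integral_cong simp: indicator_def)
    also have "\<dots> = (\<integral>\<^sup>+u. \<integral>\<^sup>+\<theta>. f n u \<theta> \<partial>lborel \<partial>lborel)"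
      unfolding f nn_integral_abs_sinusoid by (simp add: ennreal_mult)
    finally show "4 * (\<integral>\<^sup>+u\<in>A n. ennreal (sqrt ((a n u)\<^sup>2 + (b n u)\<^sup>2)) \<partial>lborel)
      = (\<integral>\<^sup>+u. \<integral>\<^sup>+\<theta>. f n u \<theta> \<partial>lborel \<partial>lborel)" .
  qed
  also have "\<dots> = (\<Sum>n. \<integral>\<^sup>+\<theta>. \<integral>\<^sup>+u. f n u \<theta> \<partial>lborel \<partial>lborel)"
    using lborel_pair.Fubini[OF fm] by simp
  also have "\<dots> = (\<integral>\<^sup>+\<theta>. (\<Sum>n. \<integral>\<^sup>+u. f n u \<theta> \<partial>lborel) \<partial>lborel)"
    by (rule nn_integral_suminf[symmetric]) (use fm in measurable)
  also have "\<dots> = (\<integral>\<^sup>+\<theta>. 2 * (emeasure lborel (hproj \<theta> ` D) * indicator {0..<2 * pi} \<theta>) \<partial>lborel)"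
  proof (intro nn_integral_cong)
    fix \<theta> :: real
    have "hdir \<theta> (X n u) \<bullet> chart_normal (X n) u = a n u * sin \<theta> - b n u * cos \<theta>" for n u
      by (simp add: hdir_def a_def b_def inner_diff_left)
    then have "(\<Sum>n. \<integral>\<^sup>+u\<in>A n. ennreal \<bar>a n u * sin \<theta> - b n u * cos \<theta>\<bar> \<partial>lborel)
      = 2 * emeasure lborel (hproj \<theta> ` D)"
      using crofton_in_one_direction[OF D dec, of \<theta>] by simp
    then show "(\<Sum>n. \<integral>\<^sup>+u. f n u \<theta> \<partial>lborel)
      = 2 * (emeasure lborel (hproj \<theta> ` D) * indicator {0..<2 * pi} \<theta>)"
      unfolding f_def by (cases "\<theta> \<in> {0..<2 * pi}") simp_all
  qed
  also have "\<dots> = 2 * (\<integral>\<^sup>+\<theta>\<in>{0..<2 * pi}. emeasure lborel (hproj \<theta> ` D) \<partial>lborel)"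
    using lines_slice_measurable[OF D(1)] by (intro nn_integral_cmult) simp
  finally show ?thesis .
qed

text \<open>
  Existence of a decomposition together with the uniqueness of its value, from Crofton's formula, evaluates
  the definite description in the definition of the p-area.
\<close>

lemma p_area_eq:
  assumes D: "open D" "convex D" "bounded D" "D \<noteq> {}" "smooth_surface (frontier D)"
    and M: "emeasure lborel (lines_meeting D) = ennreal m" "m \<ge> 0"
  shows "p_area (frontier D) = ennreal (m / 2)"
proof -
  have unique: "I = ennreal (m / 2)"
    if "has_density_integral (p_area_density (frontier D)) I (frontier D)" for I
  proof -
    have eq: "4 * I = ennreal (2 * m)"
      using crofton_formula[OF D(1-4) that] emeasure_lines_meeting[OF D(1)] M
      by (simp add: ennreal_mult)
    then show ?thesis
    proof (cases I)
      case (real r)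
      then have "ennreal (4 * r) = ennreal (2 * m)"
        using eq by (simp add: ennreal_mult)
      then have "4 * r = 2 * m" using real M(2) by (subst (asm) ennreal_inj) auto
      then show ?thesis using real by simp
    next
      case top
      then show ?thesis using eq by (simp add: ennreal_mult_top)
    qed
  qed
  have "frontier D \<noteq> {}"
    using D by (intro frontier_not_empty) auto
  then obtain U X A where "chart_decomposition (frontier D) U X A"
    using chart_decomposition_exists[OF D(5)] by blast
  then have "\<exists>I. has_density_integral (p_area_density (frontier D)) I (frontier D)"
    unfolding has_density_integral_def by blast
  with unique show ?thesis
    unfolding p_area_def density_integral_def by (metis (mono_tags, lifting) the_equality)
qed

section \<open>The integral of the chord lengths\<close>

text \<open>The passage from \<open>(p, s)\<close> to \<open>(x, y)\<close> along the lines of direction \<open>\<theta>\<close> is an orthogonal reflection.\<close>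

definition reflection :: "real \<Rightarrow> real \<times> real \<Rightarrow> real \<times> real" where
  "reflection \<theta> = (\<lambda>(p, s). (p * cos \<theta> + s * sin \<theta>, p * sin \<theta> - s * cos \<theta>))"

lemma reflection_involution: "reflection \<theta> (reflection \<theta> z) = z"
proof -
  obtain p s where z: "z = (p, s)" by (cases z)
  note sc = sin_cos_products[of \<theta>]
  have "(p * cos \<theta> + s * sin \<theta>) * cos \<theta> + (p * sin \<theta> - s * cos \<theta>) * sin \<theta> = p"
    and "(p * cos \<theta> + s * sin \<theta>) * sin \<theta> - (p * sin \<theta> - s * cos \<theta>) * cos \<theta> = s"
    using sc by algebra+
  then show ?thesis by (simp add: z reflection_def)
qed

lemma bounded_linear_reflection: "bounded_linear (reflection \<theta>)"
  unfolding linear_conv_bounded_linear[symmetric]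
  by (rule linearI) (auto simp: reflection_def algebra_simps)

text \<open>
  The image of a box under the reflection has the area of the box because the Jacobian is \<open>-1\<close>; since the
  reflection is an involution, this image is also the preimage.
\<close>

lemma lborel_reflection: "lborel = distr lborel borel (reflection \<theta>)"
proof (rule lborel_eqI)
  fix l u :: "real \<times> real"
  assume le: "\<And>b. b \<in> Basis \<Longrightarrow> l \<bullet> b \<le> u \<bullet> b"
  define F where "F = vec_of \<circ> reflection \<theta>"
  have F: "bounded_linear F"
    unfolding F_def o_def
    by (rule bounded_linear_compose[OF bounded_linear_vec_of bounded_linear_reflection])
  have m: "reflection \<theta> \<in> borel_measurable borel"
    by (intro borel_measurable_continuous_onI linear_continuous_on bounded_linear_reflection)
  define T where "T = reflection \<theta> -` box l u"
  have T: "T \<in> sets borel" using measurable_sets[OF m, of "box l u"] by (simp add: T_def)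
  have "F ` box l u = pair_of -` T"
  proof (intro equalityI subsetI)
    fix z assume "z \<in> F ` box l u"
    then show "z \<in> pair_of -` T" by (auto simp: F_def T_def reflection_involution)
  next
    fix z assume "z \<in> pair_of -` T"
    then have "reflection \<theta> (pair_of z) \<in> box l u" by (simp add: T_def)
    moreover have "z = F (reflection \<theta> (pair_of z))" by (simp add: F_def reflection_involution)
    ultimately show "z \<in> F ` box l u" by blast
  qed
  moreover have "pair_of -` T \<in> sets borel"
    using measurable_sets[OF borel_measurable_pair_of T] by simp
  ultimately have img: "emeasure lebesgue (F ` box l u) = emeasure lborel T"
    using T by (subst lborel_pair_of) (simp add: emeasure_distr emeasure_completion)
  have "det2 (F (1, 0)) (F (0, 1)) = - (sin \<theta> * sin \<theta> + cos \<theta> * cos \<theta>)"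
    by (simp add: F_def reflection_def det2_def)
  then have det: "\<bar>det2 (F (1, 0)) (F (0, 1))\<bar> = 1" by (simp add: sin_cos_products)
  have inj: "inj_on F (box l u)"
    by (rule inj_on_inverseI[where g = "reflection \<theta> \<circ> pair_of"])
       (simp add: F_def reflection_involution)
  have "(\<integral>\<^sup>+z\<in>box l u. ennreal \<bar>det2 (F (1, 0)) (F (0, 1))\<bar> \<partial>lborel) = emeasure lebesgue (F ` box l u)"
  proof (rule area_of_injective_image(2)[where F' = "\<lambda>_. F"])
    show "(F has_derivative F) (at z)" for z
      by (rule bounded_linear_imp_has_derivative[OF F])
    show "bounded (F ` box l u)" by (rule bounded_linear_image[OF bounded_box F])
    show "set_borel_measurable borel (box l u) (\<lambda>z. det2 (F (1, 0)) (F (0, 1)))"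
      unfolding set_borel_measurable_def by simp
  qed (use inj in auto)
  then have "emeasure lborel T = emeasure lborel (box l u)" by (simp add: det img)
  also have "\<dots> = (\<Prod>b\<in>Basis. (u - l) \<bullet> b)" using le by simp
  finally show "emeasure (distr lborel borel (reflection \<theta>)) (box l u) = (\<Prod>b\<in>Basis. (u - l) \<bullet> b)"
    using m by (simp add: emeasure_distr T_def)
qed simp

text \<open>
  For fixed \<open>p\<close> and \<open>s\<close> the substitution \<open>t + s * p\<close> for \<open>t\<close> is a translation. After removing it, what remains is
  the integral over the \<open>(x, y)\<close>-plane in reflected coordinates.
\<close>

lemma volume_by_lines_in_one_direction:
  assumes [measurable]: "D \<in> sets borel"
  shows "(\<integral>\<^sup>+p. \<integral>\<^sup>+t. \<integral>\<^sup>+s. indicator D (hline (p, \<theta>, t) s) \<partial>lborel \<partial>lborel \<partial>lborel)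
    = emeasure lborel D"
proof -
  define H where "H z = (\<integral>\<^sup>+t. indicator D (fst z, snd z, t) \<partial>lborel)" for z :: "real \<times> real"
  have "(\<lambda>w :: (real \<times> real) \<times> real. (fst (fst w), snd (fst w), snd w))
      \<in> borel_measurable (borel \<Otimes>\<^sub>M borel)"
    unfolding borel_prod by (intro borel_measurable_continuous_onI continuous_intros)
  from measurable_compose[OF this borel_measurable_indicator[OF assms]]
  have "(\<lambda>w :: (real \<times> real) \<times> real. indicator D (fst (fst w), snd (fst w), snd w) :: ennreal)
      \<in> borel_measurable (borel \<Otimes>\<^sub>M lborel)"
    by (subst measurable_cong_sets[OF sets_pair_measure_cong[OF refl sets_lborel] refl])
  then have H [measurable]: "H \<in> borel_measurable borel"
    unfolding H_def[abs_def]
    by (intro lborel.borel_measurable_nn_integral) (simp add: case_prod_unfold)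
  have "(\<integral>\<^sup>+t. \<integral>\<^sup>+s. indicator D (hline (p, \<theta>, t) s) \<partial>lborel \<partial>lborel)
    = (\<integral>\<^sup>+s. H (reflection \<theta> (p, s)) \<partial>lborel)" for p
  proof -
    have "(\<integral>\<^sup>+t. \<integral>\<^sup>+s. indicator D (hline (p, \<theta>, t) s) \<partial>lborel \<partial>lborel)
      = (\<integral>\<^sup>+s. \<integral>\<^sup>+t. indicator D (hline (p, \<theta>, t) s) \<partial>lborel \<partial>lborel)"
      by (rule lborel_pair.Fubini') measurable
    also have "\<dots> = (\<integral>\<^sup>+s. H (reflection \<theta> (p, s)) \<partial>lborel)"
    proof (intro nn_integral_cong)
      fix s
      define g where "g t = (indicator D (fst (reflection \<theta> (p, s)), snd (reflection \<theta> (p, s)), t) :: ennreal)" for t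
      have [measurable]: "g \<in> borel_measurable borel" unfolding g_def by measurable
      have "(\<integral>\<^sup>+t. g t \<partial>lborel) = (\<integral>\<^sup>+t. g (s * p + t) \<partial>lborel)"
        by (subst nn_integral_real_affine[of g 1 "s * p"]) simp_all
      then show "(\<integral>\<^sup>+t. indicator D (hline (p, \<theta>, t) s) \<partial>lborel) = H (reflection \<theta> (p, s))"
        by (simp add: g_def H_def hline_def reflection_def add.commute)
    qed
    finally show ?thesis .
  qed
  then have "(\<integral>\<^sup>+p. \<integral>\<^sup>+t. \<integral>\<^sup>+s. indicator D (hline (p, \<theta>, t) s) \<partial>lborel \<partial>lborel \<partial>lborel)
    = (\<integral>\<^sup>+p. \<integral>\<^sup>+s. H (reflection \<theta> (p, s)) \<partial>lborel \<partial>lborel)" by simp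
  also have "\<dots> = (\<integral>\<^sup>+z. H (reflection \<theta> z) \<partial>lborel)"
  proof (rule nn_integral_pair[symmetric])
    have "reflection \<theta> \<in> borel_measurable borel"
      by (intro borel_measurable_continuous_onI linear_continuous_on bounded_linear_reflection)
    then show "(\<lambda>z. H (reflection \<theta> z)) \<in> borel_measurable borel" by measurable
  qed
  also have "\<dots> = (\<integral>\<^sup>+z. H z \<partial>lborel)"
  proof -
    have "reflection \<theta> \<in> borel_measurable borel"
      by (intro borel_measurable_continuous_onI linear_continuous_on bounded_linear_reflection)
    then show ?thesis
      by (subst (2) lborel_reflection[of \<theta>], subst nn_integral_distr) auto
  qed
  also have "\<dots> = (\<integral>\<^sup>+x. \<integral>\<^sup>+y. \<integral>\<^sup>+t. indicator D (x, y, t) \<partial>lborel \<partial>lborel \<partial>lborel)"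
    by (subst nn_integral_pair) (simp_all add: H, simp add: H_def)
  also have "\<dots> = (\<integral>\<^sup>+x. \<integral>\<^sup>+z. indicator D (x, z) \<partial>lborel \<partial>lborel)"
    by (subst nn_integral_pair) simp_all
  also have "\<dots> = emeasure lborel D"
    by (subst nn_integral_pair[symmetric]) simp_all
  finally show ?thesis .
qed

lemma hline_speed: "levi_norm (vector_derivative (hline G) (at s)) = 1"
proof -
  obtain p \<theta> t where G: "G = (p, \<theta>, t)" by (cases G)
  have "(hline G has_vector_derivative (sin \<theta>, - cos \<theta>, p)) (at s)"
    unfolding G hline_def prod.case has_vector_derivative_def
    by (auto intro!: derivative_eq_intros simp: algebra_simps)
  then have "vector_derivative (hline G) (at s) = (sin \<theta>, - cos \<theta>, p)"
    by (rule vector_derivative_at)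
  then show ?thesis
    using sin_cos_products[of \<theta>] by (simp add: levi_norm_def levi_inner_def)
qed

lemma chord_borel:
  assumes [measurable]: "D \<in> sets borel"
  shows "{s. hline G s \<in> D} \<in> sets borel"
  by measurable

text \<open>
  The length as an integral of an indicator function, in which form Tonelli applies. Boundedness rules out
  an infinite value, which the real-valued \<open>chord_length\<close> would turn into \<open>0\<close>.
\<close>

lemma chord_length_eq:
  assumes "D \<in> sets borel"
  shows "chord_length D G = enn2real (\<integral>\<^sup>+s. indicator D (hline G s) \<partial>lborel)"
    and "bounded D \<Longrightarrow> ennreal (chord_length D G) = (\<integral>\<^sup>+s. indicator D (hline G s) \<partial>lborel)"
proof -
  let ?S = "{s. hline G s \<in> D}"
  have S: "?S \<in> sets lborel" using chord_borel[OF assms] by simp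
  have e: "(\<integral>\<^sup>+s. indicator D (hline G s) \<partial>lborel) = emeasure lborel ?S"
    using nn_integral_indicator[OF S] by (simp add: indicator_def)
  have c: "chord_length D G = measure lborel ?S"
    unfolding chord_length_def hline_speed set_lebesgue_integral_def by simp
  then show "chord_length D G = enn2real (\<integral>\<^sup>+s. indicator D (hline G s) \<partial>lborel)"
    by (simp add: e measure_def)
  assume "bounded D"
  then obtain B where B: "\<And>q. q \<in> D \<Longrightarrow> norm q \<le> B" by (auto simp: bounded_iff)
  obtain p \<theta> t where G: "G = (p, \<theta>, t)" by (cases G)
  have "bounded ?S"
    unfolding bounded_iff using hline_parameters_bounded(1)[of p \<theta> t _ D B] B by (auto simp: G)
  then have "emeasure lborel ?S < \<infinity>" by (rule emeasure_bounded_finite)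
  then show "ennreal (chord_length D G) = (\<integral>\<^sup>+s. indicator D (hline G s) \<partial>lborel)"
    unfolding e c by (simp add: emeasure_eq_ennreal_measure)
qed

lemma nn_integral_chord_length:
  assumes "open D" "bounded D"
  shows "(\<integral>\<^sup>+G\<in>lines_meeting D. ennreal (chord_length D G) \<partial>lborel)
    = ennreal (2 * pi) * emeasure lborel D"
proof -
  have D [measurable]: "D \<in> sets borel" using assms by simp
  have m: "(\<lambda>G. (\<integral>\<^sup>+s. indicator D (hline G s) \<partial>lborel)) \<in> borel_measurable borel" by measurable
  have "(\<integral>\<^sup>+G\<in>lines_meeting D. ennreal (chord_length D G) \<partial>lborel)
    = (\<integral>\<^sup>+G\<in>strip. (\<integral>\<^sup>+s. indicator D (hline G s) \<partial>lborel) \<partial>lborel)"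
  proof (intro nn_integral_cong)
    fix G
    have "(\<integral>\<^sup>+s. indicator D (hline G s) \<partial>lborel) = 0" if "range (hline G) \<inter> D = {}"
    proof -
      have "hline G s \<notin> D" for s using that by blast
      then show ?thesis by simp
    qed
    then show "ennreal (chord_length D G) * indicator (lines_meeting D) G
        = (\<integral>\<^sup>+s. indicator D (hline G s) \<partial>lborel) * indicator strip G"
      unfolding chord_length_eq(2)[OF D assms(2)] lines_meeting_strip by (simp add: indicator_def)
  qed
  also have "\<dots> = (\<integral>\<^sup>+\<theta>. \<integral>\<^sup>+p. \<integral>\<^sup>+t. (\<integral>\<^sup>+s. indicator D (hline (p, \<theta>, t) s) \<partial>lborel) * indicator strip (p, \<theta>, t)
      \<partial>lborel \<partial>lborel \<partial>lborel)"
    using m by (intro nn_integral_lines) measurable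
  also have "\<dots> = (\<integral>\<^sup>+\<theta>. emeasure lborel D * indicator {0..<2 * pi} \<theta> \<partial>lborel)"
  proof (intro nn_integral_cong)
    fix \<theta> :: real
    have "indicator strip (p, \<theta>, t) = (indicator {0..<2 * pi} \<theta> :: ennreal)" for p t :: real
      by (simp add: strip_def indicator_def)
    then show "(\<integral>\<^sup>+p. \<integral>\<^sup>+t. (\<integral>\<^sup>+s. indicator D (hline (p, \<theta>, t) s) \<partial>lborel) * indicator strip (p, \<theta>, t) \<partial>lborel \<partial>lborel)
      = emeasure lborel D * indicator {0..<2 * pi} \<theta>"
      using volume_by_lines_in_one_direction[OF D, of \<theta>]
      by (cases "\<theta> \<in> {0..<2 * pi}") simp_all
  qed
  also have "\<dots> = ennreal (2 * pi) * emeasure lborel D"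
    by (subst nn_integral_cmult) (simp_all add: mult.commute)
  finally show ?thesis .
qed

section \<open>The average chord length\<close>

theorem corollary1p3:
  fixes D :: "heis set"
  assumes "open D" and "D \<noteq> {}" and "convex D" and "bounded D"
    and "smooth_surface (frontier D)"
  shows "set_integrable lborel (lines_meeting D) (chord_length D) \<and>
    set_integrable lborel (lines_meeting D) (\<lambda>G. 1 :: real) \<and>
    (LINT G:lines_meeting D|lborel. 1 :: real) > 0 \<and>
    0 < p_area (frontier D) \<and> p_area (frontier D) < \<infinity> \<and>
    (LINT G:lines_meeting D|lborel. chord_length D G) / (LINT G:lines_meeting D|lborel. 1)
      = 2 * pi * measure lborel D / (2 * enn2real (p_area (frontier D)))"
proof -
  have D [measurable]: "D \<in> sets borel" using assms by simp
  have L [measurable]: "lines_meeting D \<in> sets borel" by (rule lines_meeting_borel[OF assms(1)])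
  define m where "m = measure lborel (lines_meeting D)"
  have fin: "emeasure lborel (lines_meeting D) < \<infinity>"
    by (rule emeasure_bounded_finite[OF bounded_lines_meeting[OF assms(4)]])
  then have M: "emeasure lborel (lines_meeting D) = ennreal m"
    unfolding m_def by (simp add: emeasure_eq_ennreal_measure)
  then have m: "m > 0"
    using emeasure_lines_meeting_pos[OF assms(1,2)] by simp
  then have area: "p_area (frontier D) = ennreal (m / 2)"
    by (intro p_area_eq assms M) simp
  have one: "set_integrable lborel (lines_meeting D) (\<lambda>G. 1 :: real)"
    using fin L by (simp add: set_integrable_def)
  have int_one: "(LINT G:lines_meeting D|lborel. 1 :: real) = m"
    by (simp add: set_lebesgue_integral_def m_def)
  have finD: "emeasure lborel D < \<infinity>" by (rule emeasure_bounded_finite[OF assms(4)])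
  let ?f = "\<lambda>G. indicator (lines_meeting D) G *\<^sub>R chord_length D G"
  have "(\<lambda>G. enn2real (\<integral>\<^sup>+s. indicator D (hline G s) \<partial>lborel)) \<in> borel_measurable borel" by measurable
  then have fm: "?f \<in> borel_measurable lborel"
    unfolding chord_length_eq(1)[OF D, abs_def, symmetric] by measurable
  have f0: "?f G \<ge> 0" for G by (simp add: chord_length_eq(1)[OF D])
  have "(\<integral>\<^sup>+G. ennreal (?f G) \<partial>lborel) = (\<integral>\<^sup>+G\<in>lines_meeting D. ennreal (chord_length D G) \<partial>lborel)"
    by (intro nn_integral_cong) (simp add: indicator_def)
  also have "\<dots> = ennreal (2 * pi) * ennreal (measure lborel D)"
    using nn_integral_chord_length[OF assms(1,4)] finD by (simp add: emeasure_eq_ennreal_measure)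
  finally have nn: "(\<integral>\<^sup>+G. ennreal (?f G) \<partial>lborel) = ennreal (2 * pi * measure lborel D)"
    by (simp add: ennreal_mult)
  have chord: "set_integrable lborel (lines_meeting D) (chord_length D)"
    unfolding set_integrable_def using fm f0 nn by (intro integrableI_nonneg) auto
  have int_chord: "(LINT G:lines_meeting D|lborel. chord_length D G) = 2 * pi * measure lborel D"
    unfolding set_lebesgue_integral_def
    using integral_eq_nn_integral[OF fm] f0 nn by simp
  show ?thesis
    using chord one m by (simp add: int_one int_chord area)
qed

end
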